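(* Let $p_1,p_2\ge 2$ be integers, $p:=p_1p_2$, and let $J$ be a $(p_1,p_2)$-periodic Jacobi-block-Jacobi operator on $\ell^2(\mathbb{Z},\ell^2(\mathbb{Z}))$ with symbol $\mathcal{S}(x_1,x_2)$, $(x_1,x_2)\in\mathbb{T}^2=[0,2\pi)\times[0,2\pi)$ (both defined in the context). Let $\lambda_1(x_1,x_2)\ge\lambda_2(x_1,x_2)\ge\dots\ge\lambda_p(x_1,x_2)$ be the eigenvalues of the Hermitian $p\times p$ matrix $\mathcal{S}(x_1,x_2)$, counted with multiplicity and labeled in non-increasing order. Then the spectrum of $J$ has the banded structure $$\sigma(J)=\bigcup_{k=1}^{p}\Lambda_k,\qquad \Lambda_k:=\Bigl[\inf_{\mathbb{T}^2}\lambda_k(x_1,x_2),\ \sup_{\mathbb{T}^2}\lambda_k(x_1,x_2)\Bigr].$$ Consequently, the number of gaps in the spectrum (bounded connected components of $\mathbb{R}\setminus\sigma(J)$) does not exceed $p-1$.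
   Context: A double sequence $\{w_{q,r}\}_{q,r\in\mathbb{Z}}$ of complex numbers is $(p_1,p_2)$-periodic if $w_{q+k_1p_1,\,r+k_2p_2}=w_{q,r}$ for all $q,r,k_1,k_2\in\mathbb{Z}$. For a bounded real sequence $\{d_r\}_{r\in\mathbb{Z}}$ and a bounded complex sequence $\{e_r\}_{r\in\mathbb{Z}}$, $J(\{d_r\},\{e_r\})$ denotes the Hermitian Jacobi matrix on $\ell^2(\mathbb{Z})$ given by $(J(\{d_r\},\{e_r\})v)_r=\overline{e_{r-1}}\,v_{r-1}+d_r v_r+e_r v_{r+1}$. A Jacobi-block-Jacobi operator $J$ acts on $\ell^2(\mathbb{Z},\ell^2(\mathbb{Z}))$ by $$(Ju)_q=A_{q-1}u_{q-1}+B_qu_q+A_qu_{q+1},\qquad q\in\mathbb{Z},\quad u_q\in\ell^2(\mathbb{Z}),$$ with $A_q=J(\{a_{q,r}\}_{r},\{\alpha_{q,r}\}_{r})$ and $B_q=J(\{c_{q,r}\}_{r},\{b_{q,r}\}_{r})$, where $a_{q,r},c_{q,r}\in\mathbb{R}$ and $\alpha_{q,r},b_{q,r}\in\mathbb{C}$. It is $(p_1,p_2)$-periodic if $\{a_{q,r}\},\{\alpha_{q,r}\},\{c_{q,r}\},\{b_{q,r}\}$ are all $(p_1,p_2)$-periodic; then $J$ is bounded and self-adjoint. Symbol. For $n=1,\dots,p_1$ and $x_2\in[0,2\pi)$ define Hermitian $p_2\times p_2$ matrices $\mathcal{A}_n(x_2)$, $\mathcal{B}_n(x_2)$ as follows.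 If $p_2\ge3$, $\mathcal{A}_n(x_2)$ has diagonal entries $a_{n,1},\dots,a_{n,p_2}$; entries $\alpha_{n,r}$ at position $(r,r+1)$ and $\overline{\alpha_{n,r}}$ at position $(r+1,r)$ for $1\le r\le p_2-1$; entry $e^{ix_2}\overline{\alpha_{n,p_2}}$ at position $(1,p_2)$ and $e^{-ix_2}\alpha_{n,p_2}$ at position $(p_2,1)$; all other entries are zero. If $p_2=2$, $$\mathcal{A}_n(x_2)=\begin{bmatrix} a_{n,1} & \alpha_{n,1}+e^{ix_2}\overline{\alpha_{n,2}}\\ \overline{\alpha_{n,1}}+e^{-ix_2}\alpha_{n,2} & a_{n,2}\end{bmatrix}.$$ In both cases $\mathcal{B}_n(x_2)$ is defined by the same formulas with $a_{n,r}$ replaced by $c_{n,r}$ and $\alpha_{n,r}$ replaced by $b_{n,r}$. The symbol $\mathcal{S}(x_1,x_2)$ is the Hermitian $p_1\times p_1$ block matrix with $p_2\times p_2$ blocks defined as follows. If $p_1\ge3$, its diagonal blocks are $\mathcal{B}_1,\dots,\mathcal{B}_{p_1}$; the blocks at positions $(n,n+1)$ and $(n+1,n)$ are $\mathcal{A}_n$ for $1\le n\le p_1-1$; the block at position $(1,p_1)$ is $e^{ix_1}\mathcal{A}_{p_1}$ and at position $(p_1,1)$ is $e^{-ix_1}\mathcal{A}_{p_1}$; all other blocks are zero (here $\mathcal{A}_n=\mathcal{A}_n(x_2)$, $\mathcal{B}_n=\mathcal{B}_n(x_2)$). If $p_1=2$, $$\mathcal{S}(x_1,x_2)=\begin{bmatrix}\mathcal{B}_1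 & \mathcal{A}_1+e^{ix_1}\mathcal{A}_2\\ \mathcal{A}_1+e^{-ix_1}\mathcal{A}_2 & \mathcal{B}_2\end{bmatrix}.$$ *)

theory Defs
  imports "HOL-Analysis.Analysis" "Jordan_Normal_Form.Char_Poly"
begin

text \<open>
  \<open>ell2 X nrm\<close> is the space of square-summable sequences indexed by the integers with values in a
  normed space that is given by its carrier \<open>X\<close> and its norm \<open>nrm\<close>. The construction is iterated
  to obtain the space of square-summable sequences of square-summable sequences.
\<close>

definition ell2 :: "'a set \<Rightarrow> ('a \<Rightarrow> real) \<Rightarrow> (int \<Rightarrow> 'a) set" where
  "ell2 X nrm = {u. (\<forall>q. u q \<in> X) \<and> (\<lambda>q. (nrm (u q))\<^sup>2) summable_on UNIV}"

definition ell2_norm :: "('a \<Rightarrow> real) \<Rightarrow> (int \<Rightarrow> 'a) \<Rightarrow> real" where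
  "ell2_norm nrm u = sqrt (\<Sum>\<^sub>\<infinity>q. (nrm (u q))\<^sup>2)"

definition ell2Z :: "(int \<Rightarrow> complex) set" where
  "ell2Z = ell2 UNIV cmod"

definition norm_ell2Z :: "(int \<Rightarrow> complex) \<Rightarrow> real" where
  "norm_ell2Z = ell2_norm cmod"

definition ell2ZZ :: "(int \<Rightarrow> int \<Rightarrow> complex) set" where
  "ell2ZZ = ell2 ell2Z norm_ell2Z"

definition norm_ell2ZZ :: "(int \<Rightarrow> int \<Rightarrow> complex) \<Rightarrow> real" where
  "norm_ell2ZZ = ell2_norm norm_ell2Z"

text \<open>Operators on \<open>ell2ZZ\<close> are functions on all double sequences; only their values on \<open>ell2ZZ\<close>
  matter.\<close>

definition bounded_operator ::
    "((int \<Rightarrow> int \<Rightarrow> complex) \<Rightarrow> (int \<Rightarrow> int \<Rightarrow> complex)) \<Rightarrow> bool" where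
  "bounded_operator T \<longleftrightarrow>
     (\<forall>u\<in>ell2ZZ. T u \<in> ell2ZZ) \<and>
     (\<forall>u\<in>ell2ZZ. \<forall>v\<in>ell2ZZ. T (\<lambda>q r. u q r + v q r) = (\<lambda>q r. T u q r + T v q r)) \<and>
     (\<forall>z. \<forall>u\<in>ell2ZZ. T (\<lambda>q r. z * u q r) = (\<lambda>q r. z * T u q r)) \<and>
     (\<exists>C. \<forall>u\<in>ell2ZZ. norm_ell2ZZ (T u) \<le> C * norm_ell2ZZ u)"

definition shifted_operator ::
    "((int \<Rightarrow> int \<Rightarrow> complex) \<Rightarrow> (int \<Rightarrow> int \<Rightarrow> complex)) \<Rightarrow> complex
     \<Rightarrow> (int \<Rightarrow> int \<Rightarrow> complex) \<Rightarrow> (int \<Rightarrow> int \<Rightarrow> complex)" where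
  "shifted_operator T z u = (\<lambda>q r. T u q r - z * u q r)"

definition operator_spectrum ::
    "((int \<Rightarrow> int \<Rightarrow> complex) \<Rightarrow> (int \<Rightarrow> int \<Rightarrow> complex)) \<Rightarrow> complex set" where
  "operator_spectrum T =
     {z. \<not> (\<exists>R. bounded_operator R \<and>
               (\<forall>u\<in>ell2ZZ. R (shifted_operator T z u) = u \<and> shifted_operator T z (R u) = u))}"

definition doubly_periodic :: "nat \<Rightarrow> nat \<Rightarrow> (int \<Rightarrow> int \<Rightarrow> 'a) \<Rightarrow> bool" where
  "doubly_periodic p1 p2 w \<longleftrightarrow>
     (\<forall>q r k1 k2. w (q + k1 * int p1) (r + k2 * int p2) = w q r)"

definition jacobi_op ::
    "(int \<Rightarrow> real) \<Rightarrow> (int \<Rightarrow> complex) \<Rightarrow> (int \<Rightarrow> complex) \<Rightarrow> (int \<Rightarrow> complex)" where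
  "jacobi_op d e v = (\<lambda>r. cnj (e (r - 1)) * v (r - 1) + complex_of_real (d r) * v r + e r * v (r + 1))"

definition jacobi_block_jacobi ::
    "(int \<Rightarrow> int \<Rightarrow> real) \<Rightarrow> (int \<Rightarrow> int \<Rightarrow> complex) \<Rightarrow>
     (int \<Rightarrow> int \<Rightarrow> real) \<Rightarrow> (int \<Rightarrow> int \<Rightarrow> complex) \<Rightarrow>
     (int \<Rightarrow> int \<Rightarrow> complex) \<Rightarrow> (int \<Rightarrow> int \<Rightarrow> complex)" where
  "jacobi_block_jacobi a \<alpha> c b u =
     (\<lambda>q r. jacobi_op (a (q - 1)) (\<alpha> (q - 1)) (u (q - 1)) r
           + jacobi_op (c q) (b q) (u q) r
           + jacobi_op (a q) (\<alpha> q) (u (q + 1)) r)"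

text \<open>Matrix entries are indexed from 0, while the coefficient sequences enter the symbol with the
  indices \<open>1, \<dots>, p\<close>; hence the shifts by one below.\<close>

definition jacobi_symbol ::
    "nat \<Rightarrow> (int \<Rightarrow> real) \<Rightarrow> (int \<Rightarrow> complex) \<Rightarrow> real \<Rightarrow> complex mat" where
  "jacobi_symbol p d e x =
     (if p = 2 then
        mat_of_rows_list 2
          [[complex_of_real (d 1), e 1 + cis x * cnj (e 2)],
           [cnj (e 1) + cis (- x) * e 2, complex_of_real (d 2)]]
      else
        mat p p (\<lambda>(i, j). let r = int i + 1; s = int j + 1 in
          if r = s then complex_of_real (d r)
          else if s = r + 1 then e r
          else if r = s + 1 then cnj (e s)
          else if r = 1 \<and> s = int p then cis x * cnj (e (int p))
          else if r = int p \<and> s = 1 then cis (- x) * e (int p)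
          else 0))"

definition block_matrix :: "nat \<Rightarrow> nat \<Rightarrow> (int \<Rightarrow> int \<Rightarrow> complex mat) \<Rightarrow> complex mat" where
  "block_matrix p1 p2 F =
     mat (p1 * p2) (p1 * p2)
       (\<lambda>(i, j). F (int (i div p2) + 1) (int (j div p2) + 1) $$ (i mod p2, j mod p2))"

definition jbj_symbol ::
    "nat \<Rightarrow> nat \<Rightarrow> (int \<Rightarrow> int \<Rightarrow> real) \<Rightarrow> (int \<Rightarrow> int \<Rightarrow> complex) \<Rightarrow>
     (int \<Rightarrow> int \<Rightarrow> real) \<Rightarrow> (int \<Rightarrow> int \<Rightarrow> complex) \<Rightarrow> real \<Rightarrow> real \<Rightarrow> complex mat" where
  "jbj_symbol p1 p2 a \<alpha> c b x1 x2 =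
     (let A = (\<lambda>n. jacobi_symbol p2 (a n) (\<alpha> n) x2);
          B = (\<lambda>n. jacobi_symbol p2 (c n) (b n) x2)
      in block_matrix p1 p2
           (if p1 = 2 then
              (\<lambda>n m. if n = m then B n
                     else if n < m then A 1 + cis x1 \<cdot>\<^sub>m A 2
                     else A 1 + cis (- x1) \<cdot>\<^sub>m A 2)
            else
              (\<lambda>n m. if n = m then B n
                     else if m = n + 1 then A n
                     else if n = m + 1 then A m
                     else if n = 1 \<and> m = int p1 then cis x1 \<cdot>\<^sub>m A (int p1)
                     else if n = int p1 \<and> m = 1 then cis (- x1) \<cdot>\<^sub>m A (int p1)
                     else 0\<^sub>m p2 p2)))"

text \<open>The eigenvalues with (algebraic) multiplicity are the roots of the characteristic polynomial;
  for a Hermitian matrix they are real and \<open>Re\<close> merely changes their type. The index \<open>k\<close> counts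
  from 1.\<close>

definition nth_eigenvalue :: "complex mat \<Rightarrow> nat \<Rightarrow> real" where
  "nth_eigenvalue M k = rev (sorted_list_of_multiset (image_mset Re (proots (char_poly M)))) ! (k - 1)"

definition torus :: "(real \<times> real) set" where
  "torus = {0..<2 * pi} \<times> {0..<2 * pi}"

definition band :: "(real \<Rightarrow> real \<Rightarrow> real) \<Rightarrow> real set" where
  "band f = {(INF (x1, x2)\<in>torus. f x1 x2) .. (SUP (x1, x2)\<in>torus. f x1 x2)}"

definition spectral_gaps :: "complex set \<Rightarrow> real set set" where
  "spectral_gaps \<sigma> = {G \<in> components {t. complex_of_real t \<notin> \<sigma>}. bounded G}"

end

theory Submission
  imports Defs
begin

text \<open>Let \<open>S x\<close> be the symbol at the point \<open>x = (x1, x2)\<close> of the torus. The heart of the matter is that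
  the spectrum of \<open>J\<close> is the set of all eigenvalues of all matrices \<open>S x\<close> (\<open>operator_spectrum_jbj\<close>).

  A double sequence is a Bloch function with phase \<open>x\<close> if moving by one period in either direction
  multiplies it by \<open>cis (- x1)\<close> or \<open>cis (- x2)\<close>. It is determined by its values on one period cell,
  a vector of length \<open>p1 * p2\<close>. Since the coefficients are periodic, \<open>J\<close> maps Bloch functions to Bloch
  functions of the same phase, and on the vector of cell values it acts as \<open>S x\<close>
  (\<open>jbj_symbol_mult_bloch\<close>). Both inclusions rest on this identity.

  If \<open>z\<close> is an eigenvalue of \<open>S x\<close>, then an eigenvector extends to a bounded Bloch function \<open>w\<close> with
  \<open>J w = z w\<close>. Cut \<open>w\<close> off outside a box of \<open>N \<times> N\<close> cells. The norm of the result grows like \<open>N\<close>, whereas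
  \<open>J - z\<close> maps it to a bounded function that lives near the boundary of the box and so has a norm of
  order \<open>sqrt N\<close>. Hence \<open>J - z\<close> is not bounded below and has no bounded inverse
  (\<open>eigenvalue_symbol_not_bounded_below\<close>).

  If \<open>z\<close> is an eigenvalue of no \<open>S x\<close>, then compactness of the torus and Cramer's rule bound the
  matrices \<open>S x - z\<close> below uniformly in \<open>x\<close>. A finitely supported \<open>u\<close> is split into Bloch functions by
  summing its translates with phases; a finite grid of phases suffices for a Plancherel identity, and
  this carries the lower bound over to \<open>J - z\<close> (\<open>shifted_jbj_bounded_below\<close>). The adjoint
  \<open>J - cnj z\<close> is bounded below in the same way, so that \<open>(J - z) (J - cnj z)\<close> is coercive, hence
  surjective. Thus \<open>J - z\<close> is a bijection with a bounded inverse.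

  It remains to see that the eigenvalues of the symbol fill the bands. Let \<open>x\<close> converge on the torus.
  The ordered eigenvalues stay bounded, and every limit point of them consists of the ordered roots of
  the limit of the characteristic polynomials. Hence the \<open>k\<close>-th largest eigenvalue is continuous
  (\<open>continuous_on_nth_eigenvalue\<close>), and its range over the torus, which is a continuous image of the
  compact connected square, is the closed interval \<open>\<Lambda>\<^sub>k\<close>. Finally the right end of a bounded gap is the left
  end of some band, but not the least left end of all, and distinct gaps have distinct right ends
  (\<open>finite_union_intervals_gaps\<close>).\<close>

section \<open>The Hilbert space of square-summable functions\<close>

no_notation Matrix.scalar_prod (infix \<open>\<bullet>\<close> 70)

text \<open>As a type, the space inherits the library of real inner product spaces. The real inner product
  (the real part of the complex one) is all that is needed below: it has the same norm, and an operator
  that is bounded below for it can be inverted just as well.\<close>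

typedef 'i l2 = "{f :: 'i \<Rightarrow> complex. (\<lambda>i. (cmod (f i))\<^sup>2) summable_on UNIV}"
  morphisms l2_apply Abs_l2
  by (rule exI[of _ "\<lambda>_. 0"]) simp

setup_lifting type_definition_l2

lemma square_summable_add:
  fixes f g :: "'i \<Rightarrow> complex"
  assumes "(\<lambda>i. (cmod (f i))\<^sup>2) summable_on UNIV" and "(\<lambda>i. (cmod (g i))\<^sup>2) summable_on UNIV"
  shows "(\<lambda>i. (cmod (f i + g i))\<^sup>2) summable_on UNIV"
proof (rule summable_on_comparison_test)
  show "(\<lambda>i. 2 * (cmod (f i))\<^sup>2 + 2 * (cmod (g i))\<^sup>2) summable_on UNIV"
    by (intro summable_on_add summable_on_cmult_right assms)
  fix i
  have "(cmod (f i + g i))\<^sup>2 \<le> (cmod (f i) + cmod (g i))\<^sup>2"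
    by (intro power_mono norm_triangle_ineq) auto
  also have "\<dots> \<le> 2 * (cmod (f i))\<^sup>2 + 2 * (cmod (g i))\<^sup>2"
    using sum_squares_bound[of "cmod (f i)" "cmod (g i)"] by (simp add: power2_sum)
  finally show "(cmod (f i + g i))\<^sup>2 \<le> 2 * (cmod (f i))\<^sup>2 + 2 * (cmod (g i))\<^sup>2" .
qed auto

lemma square_summable_mult:
  fixes f g :: "'i \<Rightarrow> complex"
  assumes "(\<lambda>i. (cmod (f i))\<^sup>2) summable_on UNIV" and "\<And>i. cmod (g i) \<le> C"
  shows "(\<lambda>i. (cmod (g i * f i))\<^sup>2) summable_on UNIV"
proof (rule summable_on_comparison_test)
  show "(\<lambda>i. C\<^sup>2 * (cmod (f i))\<^sup>2) summable_on UNIV"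
    by (intro summable_on_cmult_right assms)
  show "(cmod (g i * f i))\<^sup>2 \<le> C\<^sup>2 * (cmod (f i))\<^sup>2" for i
    using assms(2)[of i] by (auto simp: norm_mult power_mult_distrib intro!: mult_right_mono power_mono)
qed auto

lemma square_summable_inner:
  fixes f g :: "'i \<Rightarrow> complex"
  assumes "(\<lambda>i. (cmod (f i))\<^sup>2) summable_on UNIV" and "(\<lambda>i. (cmod (g i))\<^sup>2) summable_on UNIV"
  shows "(\<lambda>i. f i \<bullet> g i) summable_on UNIV"
proof -
  have "(\<lambda>i. norm (f i \<bullet> g i)) summable_on UNIV"
  proof (rule summable_on_comparison_test)
    show "(\<lambda>i. (cmod (f i))\<^sup>2 + (cmod (g i))\<^sup>2) summable_on UNIV"
      by (intro summable_on_add assms)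
    show "norm (f i \<bullet> g i) \<le> (cmod (f i))\<^sup>2 + (cmod (g i))\<^sup>2" for i
      using Cauchy_Schwarz_ineq2[of "f i" "g i"] sum_squares_bound[of "cmod (f i)" "cmod (g i)"]
        zero_le_mult_iff[of "cmod (f i)" "cmod (g i)"] by simp
  qed auto
  then show ?thesis by (simp add: abs_summable_summable)
qed

instantiation l2 :: (type) real_vector
begin

lift_definition zero_l2 :: "'a l2" is "\<lambda>_. 0" by simp
lift_definition plus_l2 :: "'a l2 \<Rightarrow> 'a l2 \<Rightarrow> 'a l2" is "\<lambda>f g i. f i + g i"
  by (rule square_summable_add)
lift_definition uminus_l2 :: "'a l2 \<Rightarrow> 'a l2" is "\<lambda>f i. - f i" by simp
lift_definition minus_l2 :: "'a l2 \<Rightarrow> 'a l2 \<Rightarrow> 'a l2" is "\<lambda>f g i. f i - g i"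
  using square_summable_add[of f "\<lambda>i. - g i" for f g] by simp
lift_definition scaleR_l2 :: "real \<Rightarrow> 'a l2 \<Rightarrow> 'a l2" is "\<lambda>t f i. t *\<^sub>R f i"
  by (simp add: power_mult_distrib summable_on_cmult_right)

instance
  by standard (transfer; simp add: algebra_simps)+

end

instantiation l2 :: (type) real_inner
begin

lift_definition inner_l2 :: "'a l2 \<Rightarrow> 'a l2 \<Rightarrow> real" is "\<lambda>f g. \<Sum>\<^sub>\<infinity>i. f i \<bullet> g i" .
definition norm_l2 :: "'a l2 \<Rightarrow> real" where "norm_l2 u = sqrt (u \<bullet> u)"
definition dist_l2 :: "'a l2 \<Rightarrow> 'a l2 \<Rightarrow> real" where "dist_l2 u v = norm (u - v)"
definition sgn_l2 :: "'a l2 \<Rightarrow> 'a l2" where "sgn_l2 u = inverse (norm u) *\<^sub>R u"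
definition uniformity_l2 :: "('a l2 \<times> 'a l2) filter" where
  "uniformity_l2 = (INF e\<in>{0<..}. principal {(u, v). dist u v < e})"
definition open_l2 :: "'a l2 set \<Rightarrow> bool" where
  "open_l2 U \<longleftrightarrow> (\<forall>x\<in>U. \<forall>\<^sub>F (x', y) in uniformity. x' = x \<longrightarrow> y \<in> U)"

instance
proof
  fix u v w :: "'a l2" and t :: real
  show "inner u v = inner v u"
    by transfer (simp add: inner_commute)
  show "inner (u + v) w = inner u w + inner v w"
    by transfer (simp add: inner_add_left infsum_add square_summable_inner)
  show "inner (t *\<^sub>R u) v = t * inner u v"
    by transfer (simp add: infsum_cmult_right' del: scaleR_conv_of_real)
  show "0 \<le> inner u u"
    by transfer (simp add: infsum_nonneg)
  show "(inner u u = 0) = (u = 0)"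
  proof transfer
    fix f :: "'a \<Rightarrow> complex"
    assume "(\<lambda>i. (cmod (f i))\<^sup>2) summable_on UNIV"
    then have "f i = 0" if "(\<Sum>\<^sub>\<infinity>i. f i \<bullet> f i) = 0" for i
      using nonneg_infsum_le_0D[of "\<lambda>i. f i \<bullet> f i" UNIV i] that
      by (simp add: dot_square_norm)
    then show "((\<Sum>\<^sub>\<infinity>i. f i \<bullet> f i) = 0) = (f = (\<lambda>_. 0))"
      by (intro iffI ext) (assumption | simp)+
  qed
  show "norm u = sqrt (inner u u)" by (rule norm_l2_def)
  show "dist u v = norm (u - v)" by (rule dist_l2_def)
  show "sgn u = u /\<^sub>R norm u" by (rule sgn_l2_def)
  show "(uniformity :: ('a l2 \<times> 'a l2) filter) = (INF e\<in>{0<..}. principal {(u, v). dist u v < e})"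
    by (rule uniformity_l2_def)
  show "open U \<longleftrightarrow> (\<forall>x\<in>U. \<forall>\<^sub>F (x', y) in uniformity. x' = x \<longrightarrow> y \<in> U)" for U :: "'a l2 set"
    by (rule open_l2_def)
qed

end

lemma norm_l2_square: "(norm u)\<^sup>2 = (\<Sum>\<^sub>\<infinity>i. (cmod (l2_apply u i))\<^sup>2)"
  by (simp add: power2_norm_eq_inner inner_l2.rep_eq)

lemma square_summable_l2_apply: "(\<lambda>i. (cmod (l2_apply u i))\<^sup>2) summable_on UNIV"
  using l2_apply[of u] by simp

lemma sum_le_norm_l2_square:
  assumes "finite F"
  shows "(\<Sum>i\<in>F. (cmod (l2_apply u i))\<^sup>2) \<le> (norm u)\<^sup>2"
  unfolding norm_l2_square using assms square_summable_l2_apply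
  by (intro finite_sum_le_infsum) auto

lemma norm_l2_apply_le: "cmod (l2_apply u i) \<le> norm u"
  using sum_le_norm_l2_square[of "{i}" u] by (simp add: abs_le_square_iff[symmetric])

text \<open>A Cauchy sequence converges pointwise, and the bounds on finite partial sums of
  \<open>(cmod (X m i - X n i))\<^sup>2\<close> survive the pointwise limit in \<open>n\<close>; so the pointwise limit is also the limit in
  norm.\<close>

instance l2 :: (type) complete_space
proof
  fix X :: "nat \<Rightarrow> 'a l2"
  assume X: "Cauchy X"
  have "Cauchy (\<lambda>n. l2_apply (X n) i)" for i
  proof (rule CauchyI)
    fix e :: real assume "0 < e"
    then obtain M where "\<And>m n. m \<ge> M \<Longrightarrow> n \<ge> M \<Longrightarrow> norm (X m - X n) < e"
      using X unfolding Cauchy_iff by blast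
    moreover have "cmod (l2_apply (X m) i - l2_apply (X n) i) \<le> norm (X m - X n)" for m n
      using norm_l2_apply_le[of "X m - X n" i] by (simp add: minus_l2.rep_eq)
    ultimately show "\<exists>M. \<forall>m\<ge>M. \<forall>n\<ge>M. cmod (l2_apply (X m) i - l2_apply (X n) i) < e"
      by (meson le_less_trans)
  qed
  then obtain f where f: "\<And>i. (\<lambda>n. l2_apply (X n) i) \<longlonglongrightarrow> f i"
    unfolding Cauchy_convergent_iff convergent_def by metis
  have bound: "(\<Sum>i\<in>F. (cmod (l2_apply (X m) i - f i))\<^sup>2) \<le> e\<^sup>2"
    if "finite F" and M: "\<And>n. n \<ge> M \<Longrightarrow> norm (X m - X n) \<le> e" for F e m M
  proof (rule LIMSEQ_le_const2)
    show "(\<lambda>n. \<Sum>i\<in>F. (cmod (l2_apply (X m) i - l2_apply (X n) i))\<^sup>2)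
            \<longlonglongrightarrow> (\<Sum>i\<in>F. (cmod (l2_apply (X m) i - f i))\<^sup>2)"
      by (intro tendsto_intros f)
    show "\<exists>N. \<forall>n\<ge>N. (\<Sum>i\<in>F. (cmod (l2_apply (X m) i - l2_apply (X n) i))\<^sup>2) \<le> e\<^sup>2"
    proof (intro exI allI impI)
      fix n assume "M \<le> n"
      have "(\<Sum>i\<in>F. (cmod (l2_apply (X m) i - l2_apply (X n) i))\<^sup>2) \<le> (norm (X m - X n))\<^sup>2"
        using sum_le_norm_l2_square[OF \<open>finite F\<close>, of "X m - X n"] by (simp add: minus_l2.rep_eq)
      also have "\<dots> \<le> e\<^sup>2"
        using M[OF \<open>M \<le> n\<close>] by (intro power_mono) auto
      finally show "(\<Sum>i\<in>F. (cmod (l2_apply (X m) i - l2_apply (X n) i))\<^sup>2) \<le> e\<^sup>2" .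
    qed
  qed
  have diff: "(\<lambda>i. (cmod (l2_apply (X m) i - f i))\<^sup>2) summable_on UNIV"
      "(\<Sum>\<^sub>\<infinity>i. (cmod (l2_apply (X m) i - f i))\<^sup>2) \<le> e\<^sup>2"
    if "\<And>n. n \<ge> M \<Longrightarrow> norm (X m - X n) \<le> e" for e m M
  proof -
    show summ: "(\<lambda>i. (cmod (l2_apply (X m) i - f i))\<^sup>2) summable_on UNIV"
      by (rule nonneg_bounded_partial_sums_imp_summable_on[where C = "e\<^sup>2"])
         (simp, rule eventually_finite_subsets_at_top_weakI, rule bound[OF _ that])
    show "(\<Sum>\<^sub>\<infinity>i. (cmod (l2_apply (X m) i - f i))\<^sup>2) \<le> e\<^sup>2"
      by (rule infsum_le_finite_sums[OF summ]) (rule bound[OF _ that])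
  qed
  obtain M1 where M1: "\<And>m n. m \<ge> M1 \<Longrightarrow> n \<ge> M1 \<Longrightarrow> norm (X m - X n) < 1"
    using X[unfolded Cauchy_iff, rule_format, of 1] by fastforce
  have "(\<lambda>i. (cmod (l2_apply (X M1) i + - (l2_apply (X M1) i - f i)))\<^sup>2) summable_on UNIV"
    by (rule square_summable_add[OF square_summable_l2_apply])
       (use diff(1)[of M1 M1 1, OF less_imp_le[OF M1]] in \<open>simp add: norm_minus_commute\<close>)
  then have summ_f: "(\<lambda>i. (cmod (f i))\<^sup>2) summable_on UNIV" by simp
  have "X \<longlonglongrightarrow> Abs_l2 f"
  proof (rule LIMSEQ_I)
    fix e :: real assume "0 < e"
    then obtain M where M: "\<And>m n. m \<ge> M \<Longrightarrow> n \<ge> M \<Longrightarrow> norm (X m - X n) < e / 2"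
      using X[unfolded Cauchy_iff, rule_format, OF half_gt_zero[OF \<open>0 < e\<close>]] by blast
    have "norm (X m - Abs_l2 f) < e" if "m \<ge> M" for m
    proof -
      have "(norm (X m - Abs_l2 f))\<^sup>2 \<le> (e / 2)\<^sup>2"
        unfolding norm_l2_square
        using diff(2)[of M m "e / 2", OF less_imp_le[OF M[OF that]]] summ_f
        by (simp add: minus_l2.rep_eq Abs_l2_inverse)
      then have "norm (X m - Abs_l2 f) \<le> e / 2"
        by (rule power2_le_imp_le) (use \<open>0 < e\<close> in linarith)
      then show ?thesis using \<open>0 < e\<close> by linarith
    qed
    then show "\<exists>N. \<forall>n\<ge>N. norm (X n - Abs_l2 f) < e" by blast
  qed
  then show "convergent X" unfolding convergent_def by blast
qed

section \<open>Coercive operators\<close>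

text \<open>The equation \<open>M v = w\<close> says that \<open>v\<close> is a fixed point of \<open>v \<mapsto> v - \<tau> (M v - w)\<close>. Coercivity makes this a
  contraction when \<open>\<tau>\<close> is small, because
  \<open>\<parallel>v - \<tau> M v\<parallel>\<^sup>2 \<le> (1 - 2 \<tau> \<epsilon> + \<tau>\<^sup>2 C\<^sup>2) \<parallel>v\<parallel>\<^sup>2\<close>.\<close>

lemma coercive_imp_surjective:
  fixes M :: "'a::{real_inner, complete_space} \<Rightarrow> 'a"
  assumes "linear M" and bnd: "\<And>v. norm (M v) \<le> C * norm v"
    and "\<epsilon> > 0" and coercive: "\<And>v. \<epsilon> * (norm v)\<^sup>2 \<le> M v \<bullet> v"
  shows "\<exists>v. M v = w"
proof -
  interpret linear M by fact
  \<comment> \<open>The summand \<open>\<epsilon>\<^sup>2\<close> keeps \<open>D\<close> positive and \<open>k\<close> nonnegative; \<open>\<tau>\<close> minimises \<open>1 - 2 \<tau> \<epsilon> + \<tau>\<^sup>2 D\<close>.\<close>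
  define D where "D = C\<^sup>2 + \<epsilon>\<^sup>2"
  define \<tau> where "\<tau> = \<epsilon> / D"
  define k where "k = 1 - \<epsilon>\<^sup>2 / D"
  have "D > 0" unfolding D_def using \<open>\<epsilon> > 0\<close> by (simp add: add_nonneg_pos)
  then have "\<tau> > 0" unfolding \<tau>_def using \<open>\<epsilon> > 0\<close> by simp
  have k: "0 \<le> k" "k < 1"
    using \<open>D > 0\<close> \<open>\<epsilon> > 0\<close> by (auto simp: k_def D_def divide_simps)
  have contr: "norm (v - \<tau> *\<^sub>R M v) \<le> sqrt k * norm v" for v
  proof (rule power2_le_imp_le)
    have sq: "(norm (M v))\<^sup>2 \<le> D * (norm v)\<^sup>2"
    proof -
      have "(norm (M v))\<^sup>2 \<le> (C * norm v)\<^sup>2" by (intro power_mono bnd) auto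
      also have "\<dots> \<le> D * (norm v)\<^sup>2"
        by (auto simp: D_def power_mult_distrib intro!: mult_right_mono)
      finally show ?thesis .
    qed
    have "(norm (v - \<tau> *\<^sub>R M v))\<^sup>2 = (norm v)\<^sup>2 - 2 * \<tau> * (M v \<bullet> v) + \<tau>\<^sup>2 * (norm (M v))\<^sup>2"
      unfolding power2_norm_eq_inner power2_eq_square[of \<tau>]
      by (simp add: inner_diff inner_commute algebra_simps)
    also have "\<dots> \<le> (norm v)\<^sup>2 - 2 * \<tau> * (\<epsilon> * (norm v)\<^sup>2) + \<tau>\<^sup>2 * (D * (norm v)\<^sup>2)"
      using \<open>\<tau> > 0\<close> by (intro add_mono diff_mono mult_left_mono coercive sq) auto
    also have "\<dots> = k * (norm v)\<^sup>2"
      using \<open>D > 0\<close> by (simp add: \<tau>_def k_def field_simps power2_eq_square)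
    also have "\<dots> = (sqrt k * norm v)\<^sup>2"
      using k by (simp add: power_mult_distrib)
    finally show "(norm (v - \<tau> *\<^sub>R M v))\<^sup>2 \<le> (sqrt k * norm v)\<^sup>2" .
  qed (use k in auto)
  have "\<exists>!v. v - \<tau> *\<^sub>R (M v - w) = v"
  proof (rule banach_fix_type)
    show "0 \<le> sqrt k" "sqrt k < 1" using k by auto
    show "\<forall>v v'. dist (v - \<tau> *\<^sub>R (M v - w)) (v' - \<tau> *\<^sub>R (M v' - w)) \<le> sqrt k * dist v v'"
      using contr[of "_ - _"] by (simp add: dist_norm diff algebra_simps)
  qed
  then obtain v where "\<tau> *\<^sub>R (M v - w) = 0" by auto
  then have "M v = w" using \<open>D > 0\<close> \<open>\<epsilon> > 0\<close> by (simp add: \<tau>_def)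
  then show ?thesis ..
qed

text \<open>The operator \<open>T T'\<close> is coercive, since \<open>T (T' v) \<bullet> v\<close> is the square of the norm of \<open>T' v\<close>.\<close>

lemma surj_if_adjoint_bounded_below:
  fixes T T' :: "'a::{real_inner, complete_space} \<Rightarrow> 'a"
  assumes lin: "linear T" "linear T'"
    and bnd: "\<And>v. norm (T v) \<le> C * norm v" "\<And>v. norm (T' v) \<le> C * norm v"
    and adj: "\<And>u v. T u \<bullet> v = u \<bullet> T' v"
    and "\<delta> > 0" and below: "\<And>v. \<delta> * norm v \<le> norm (T' v)"
  shows "surj T"
proof -
  have "\<exists>v. (T \<circ> T') v = w" for w
  proof (rule coercive_imp_surjective)
    show "linear (T \<circ> T')" using lin by (rule linear_compose[rotated])
    show "norm ((T \<circ> T') v) \<le> \<bar>C\<bar> * C * norm v" for v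
    proof -
      have "norm ((T \<circ> T') v) \<le> \<bar>C\<bar> * norm (T' v)"
        using bnd(1)[of "T' v"] mult_right_mono[OF abs_ge_self[of C], of "norm (T' v)"] by simp
      also have "\<dots> \<le> \<bar>C\<bar> * (C * norm v)" by (intro mult_left_mono bnd) auto
      finally show ?thesis by (simp add: mult.assoc)
    qed
    show "0 < \<delta>\<^sup>2" using \<open>\<delta> > 0\<close> by simp
    show "\<delta>\<^sup>2 * (norm v)\<^sup>2 \<le> (T \<circ> T') v \<bullet> v" for v
      using power_mono[OF below[of v], of 2] \<open>\<delta> > 0\<close>
      by (simp add: adj power_mult_distrib flip: power2_norm_eq_inner)
  qed
  then show ?thesis unfolding surj_def o_def by metis
qed

section \<open>Finite-range operators on square-summable functions\<close>

lemma l2_eqI: "(\<And>i. l2_apply u i = l2_apply v i) \<Longrightarrow> u = v"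
  by (metis ext l2_apply_inject)

lemma l2_apply_sum: "l2_apply (\<Sum>s\<in>D. f s) i = (\<Sum>s\<in>D. l2_apply (f s) i)"
  by (induction D rule: infinite_finite_induct) (auto simp: zero_l2.rep_eq plus_l2.rep_eq)

definition weighted_shift :: "('i::ab_group_add \<Rightarrow> complex) \<Rightarrow> 'i \<Rightarrow> 'i l2 \<Rightarrow> 'i l2" where
  "weighted_shift c s u = Abs_l2 (\<lambda>i. c i * l2_apply u (i + s))"

lemma bij_plus_right: "bij (\<lambda>i::'i::ab_group_add. i + s)"
  by (rule bij_betw_byWitness[where f' = "\<lambda>i. i - s"]) auto

lemma l2_apply_weighted_shift:
  assumes "\<And>i. cmod (c i) \<le> K"
  shows "l2_apply (weighted_shift c s u) i = c i * l2_apply u (i + s)"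
proof -
  have "(\<lambda>i. (cmod (l2_apply u (i + s)))\<^sup>2) summable_on UNIV"
    using summable_on_reindex_bij_betw[OF bij_plus_right[of s], of "\<lambda>i. (cmod (l2_apply u i))\<^sup>2"]
    by (simp add: square_summable_l2_apply)
  then show ?thesis
    unfolding weighted_shift_def
    by (subst Abs_l2_inverse) (auto intro!: square_summable_mult assms)
qed

lemma norm_weighted_shift_le:
  assumes K: "\<And>i. cmod (c i) \<le> K"
  shows "norm (weighted_shift c s u) \<le> K * norm u"
proof (rule power2_le_imp_le)
  have "0 \<le> K" using K[of 0] norm_ge_zero order_trans by blast
  have "(norm (weighted_shift c s u))\<^sup>2 = (\<Sum>\<^sub>\<infinity>i. (cmod (c i))\<^sup>2 * (cmod (l2_apply u (i + s)))\<^sup>2)"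
    by (simp add: norm_l2_square l2_apply_weighted_shift[OF K] norm_mult power_mult_distrib)
  also have "\<dots> \<le> (\<Sum>\<^sub>\<infinity>i. K\<^sup>2 * (cmod (l2_apply u (i + s)))\<^sup>2)"
  proof (rule infsum_mono)
    show "(\<lambda>i. (cmod (c i))\<^sup>2 * (cmod (l2_apply u (i + s)))\<^sup>2) summable_on UNIV"
      using square_summable_l2_apply[of "weighted_shift c s u"]
      by (simp add: l2_apply_weighted_shift[OF K] norm_mult power_mult_distrib)
    show "(\<lambda>i. K\<^sup>2 * (cmod (l2_apply u (i + s)))\<^sup>2) summable_on UNIV"
      using summable_on_reindex_bij_betw[OF bij_plus_right[of s], of "\<lambda>i. (cmod (l2_apply u i))\<^sup>2"]
      by (simp add: square_summable_l2_apply summable_on_cmult_right)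
  qed (intro mult_right_mono power_mono K; simp)
  also have "\<dots> = (K * norm u)\<^sup>2"
    using infsum_reindex_bij_betw[OF bij_plus_right[of s], of "\<lambda>i. (cmod (l2_apply u i))\<^sup>2"]
    by (simp add: infsum_cmult_right' norm_l2_square power_mult_distrib)
  finally show "(norm (weighted_shift c s u))\<^sup>2 \<le> (K * norm u)\<^sup>2" .
  show "0 \<le> K * norm u" using \<open>0 \<le> K\<close> by simp
qed

text \<open>The adjoint shifts back, so the conjugate weight has to be read off at the shifted position.\<close>

lemma inner_weighted_shift:
  assumes K: "\<And>i. cmod (c i) \<le> K"
  shows "weighted_shift c s u \<bullet> v = u \<bullet> weighted_shift (\<lambda>i. cnj (c (i - s))) (- s) v"
proof -
  have mult: "(z * x) \<bullet> y = x \<bullet> (cnj z * y)" for x y z :: complex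
    by (simp add: inner_complex_def algebra_simps)
  have K': "cmod (cnj (c (i - s))) \<le> K" for i using K by simp
  have "weighted_shift c s u \<bullet> v = (\<Sum>\<^sub>\<infinity>i. l2_apply u (i + s) \<bullet> (cnj (c i) * l2_apply v i))"
    by (simp add: inner_l2.rep_eq l2_apply_weighted_shift[OF K] mult)
  also have "\<dots> = (\<Sum>\<^sub>\<infinity>i. l2_apply u i \<bullet> (cnj (c (i - s)) * l2_apply v (i - s)))"
    using infsum_reindex_bij_betw[OF bij_plus_right[of s],
        of "\<lambda>i. l2_apply u i \<bullet> (cnj (c (i - s)) * l2_apply v (i - s))"]
    by simp
  also have "\<dots> = u \<bullet> weighted_shift (\<lambda>i. cnj (c (i - s))) (- s) v"
    by (simp add: inner_l2.rep_eq l2_apply_weighted_shift[OF K'])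
  finally show ?thesis .
qed

text \<open>The coefficient \<open>c s i\<close> weighs the value at distance \<open>s\<close> from \<open>i\<close>. The operator is applied both to
  square-summable functions and to Bloch functions, which are merely bounded; hence the version on all
  functions next to the one on \<open>l2\<close>.\<close>

definition finite_range_op ::
    "'i::ab_group_add set \<Rightarrow> ('i \<Rightarrow> 'i \<Rightarrow> complex) \<Rightarrow> ('i \<Rightarrow> complex) \<Rightarrow> 'i \<Rightarrow> complex" where
  "finite_range_op D c w i = (\<Sum>s\<in>D. c s i * w (i + s))"

definition finite_range_l2 ::
    "'i::ab_group_add set \<Rightarrow> ('i \<Rightarrow> 'i \<Rightarrow> complex) \<Rightarrow> 'i l2 \<Rightarrow> 'i l2" where
  "finite_range_l2 D c u = (\<Sum>s\<in>D. weighted_shift (c s) s u)"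

lemma l2_apply_finite_range_l2:
  assumes "\<And>s i. cmod (c s i) \<le> K"
  shows "l2_apply (finite_range_l2 D c u) = finite_range_op D c (l2_apply u)"
  by (intro ext)
     (simp add: finite_range_l2_def finite_range_op_def l2_apply_sum l2_apply_weighted_shift[OF assms])

lemma linear_finite_range_l2:
  assumes "\<And>s i. cmod (c s i) \<le> K"
  shows "linear (finite_range_l2 D c)"
  by (intro linearI l2_eqI)
     (simp_all add: l2_apply_finite_range_l2[OF assms] finite_range_op_def plus_l2.rep_eq
       scaleR_l2.rep_eq sum.distrib algebra_simps scaleR_sum_right)

lemma norm_finite_range_l2_le:
  assumes "\<And>s i. cmod (c s i) \<le> K"
  shows "norm (finite_range_l2 D c u) \<le> of_nat (card D) * K * norm u"
  unfolding finite_range_l2_def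
  using sum_norm_bound[of D "\<lambda>s. weighted_shift (c s) s u" "K * norm u"]
    norm_weighted_shift_le[of "c _", OF assms] by (simp add: mult.assoc)

lemma inner_finite_range_l2:
  assumes K: "\<And>s i. cmod (c s i) \<le> K" and D: "uminus ` D = D"
    and adj: "\<And>s i. s \<in> D \<Longrightarrow> c' s i = cnj (c (- s) (i + s))"
  shows "finite_range_l2 D c u \<bullet> v = u \<bullet> finite_range_l2 D c' v"
proof -
  have "finite_range_l2 D c u \<bullet> v = (\<Sum>s\<in>D. u \<bullet> weighted_shift (\<lambda>i. cnj (c s (i - s))) (- s) v)"
    by (simp add: finite_range_l2_def inner_sum_left inner_weighted_shift[OF K])
  also have "\<dots> = (\<Sum>s\<in>D. u \<bullet> weighted_shift (c' s) s v)"
  proof (rule sum.reindex_bij_witness[where i = uminus and j = uminus])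
    fix s assume "s \<in> D"
    then show "- s \<in> D" using D by auto
    then show "u \<bullet> weighted_shift (c' (- s)) (- s) v
             = u \<bullet> weighted_shift (\<lambda>i. cnj (c s (i - s))) (- s) v"
      by (simp add: adj[OF \<open>- s \<in> D\<close>, abs_def])
  next
    fix s assume "s \<in> D"
    then show "- s \<in> D" using D by auto
  qed auto
  also have "\<dots> = u \<bullet> finite_range_l2 D c' v"
    by (simp add: finite_range_l2_def inner_sum_right)
  finally show ?thesis .
qed

section \<open>Double sequences and the spectrum\<close>

definition of_l2 :: "(int \<times> int) l2 \<Rightarrow> int \<Rightarrow> int \<Rightarrow> complex" where
  "of_l2 v q r = l2_apply v (q, r)"

definition to_l2 :: "(int \<Rightarrow> int \<Rightarrow> complex) \<Rightarrow> (int \<times> int) l2" where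
  "to_l2 u = Abs_l2 (\<lambda>(q, r). u q r)"

text \<open>Summing squares row by row or over all pairs at once amounts to the same, so that
  \<open>ell2ZZ\<close> can be identified with \<open>l2\<close> over \<open>int \<times> int\<close>, isometrically by \<open>norm_of_l2\<close> below.\<close>

lemma mem_ell2ZZ_iff: "u \<in> ell2ZZ \<longleftrightarrow> (\<lambda>(q, r). (cmod (u q r))\<^sup>2) summable_on UNIV"
proof -
  have eq: "(norm_ell2Z (u q))\<^sup>2 = (\<Sum>\<^sub>\<infinity>r. (cmod (u q r))\<^sup>2)" for q
    by (simp add: norm_ell2Z_def ell2_norm_def infsum_nonneg)
  have "(\<lambda>(q, r). (cmod (u q r))\<^sup>2) summable_on UNIV \<longleftrightarrow>
      (\<lambda>x. norm (case x of (q, r) \<Rightarrow> (cmod (u q r))\<^sup>2)) summable_on UNIV \<times> UNIV"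
    by (simp add: case_prod_unfold)
  also have "\<dots> \<longleftrightarrow> (\<forall>q. (\<lambda>r. (cmod (u q r))\<^sup>2) summable_on UNIV)
      \<and> (\<lambda>q. \<Sum>\<^sub>\<infinity>r. (cmod (u q r))\<^sup>2) summable_on UNIV"
    using Infinite_Sum.abs_summable_on_Sigma_iff[of "\<lambda>(q, r). (cmod (u q r))\<^sup>2" UNIV "\<lambda>_. UNIV"]
    by (simp add: infsum_nonneg case_prod_unfold)
  also have "\<dots> \<longleftrightarrow> u \<in> ell2ZZ"
    unfolding ell2ZZ_def ell2_def ell2Z_def using eq by simp
  finally show ?thesis by simp
qed

lemma of_l2_in_ell2ZZ [simp]: "of_l2 v \<in> ell2ZZ"
  using square_summable_l2_apply[of v] by (simp add: mem_ell2ZZ_iff of_l2_def case_prod_unfold)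

lemma of_l2_to_l2: "u \<in> ell2ZZ \<Longrightarrow> of_l2 (to_l2 u) = u"
  by (intro ext) (simp add: of_l2_def to_l2_def mem_ell2ZZ_iff Abs_l2_inverse case_prod_unfold)

lemma to_l2_of_l2 [simp]: "to_l2 (of_l2 v) = v"
  by (simp add: of_l2_def to_l2_def l2_apply_inverse)

lemma norm_of_l2: "norm_ell2ZZ (of_l2 v) = norm v"
proof -
  have "(\<lambda>(q, r). (cmod (of_l2 v q r))\<^sup>2) summable_on UNIV \<times> UNIV"
    using of_l2_in_ell2ZZ[of v] by (simp add: mem_ell2ZZ_iff)
  then have "(\<Sum>\<^sub>\<infinity>q. \<Sum>\<^sub>\<infinity>r. (cmod (of_l2 v q r))\<^sup>2) = (\<Sum>\<^sub>\<infinity>(q, r). (cmod (of_l2 v q r))\<^sup>2)"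
    using infsum_Sigma'_banach[of "\<lambda>q r. (cmod (of_l2 v q r))\<^sup>2" UNIV "\<lambda>_. UNIV"] by simp
  then have "norm_ell2ZZ (of_l2 v) = sqrt ((norm v)\<^sup>2)"
    unfolding norm_l2_square
    by (simp add: norm_ell2ZZ_def norm_ell2Z_def ell2_norm_def infsum_nonneg of_l2_def case_prod_unfold)
  then show ?thesis by simp
qed

lemma of_l2_add: "of_l2 (u + v) = (\<lambda>q r. of_l2 u q r + of_l2 v q r)"
  by (intro ext) (simp add: of_l2_def plus_l2.rep_eq)

definition cscale :: "complex \<Rightarrow> 'i::ab_group_add l2 \<Rightarrow> 'i l2" where
  "cscale z = weighted_shift (\<lambda>_. z) 0"

lemma l2_apply_cscale: "l2_apply (cscale z u) i = z * l2_apply u i"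
  by (simp add: cscale_def l2_apply_weighted_shift[where K = "cmod z"])

lemma of_l2_cscale: "of_l2 (cscale z u) = (\<lambda>q r. z * of_l2 u q r)"
  by (intro ext) (simp add: of_l2_def l2_apply_cscale)

text \<open>Conjugating the inverse of \<open>T\<close> with the identification of \<open>ell2ZZ\<close> and \<open>l2\<close> yields the bounded inverse
  that the definition of the spectrum asks for.\<close>

lemma not_in_spectrum_if_bijective:
  assumes T: "\<And>v. shifted_operator S z (of_l2 v) = of_l2 (T v)"
    and lin: "\<And>u v. T (u + v) = T u + T v" "\<And>x v. T (cscale x v) = cscale x (T v)"
    and surj: "surj T" and "\<delta> > 0" and below: "\<And>v. \<delta> * norm v \<le> norm (T v)"
  shows "z \<notin> operator_spectrum S"
proof -
  have "inj T"
  proof (rule injI)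
    fix u v assume uv: "T u = T v"
    have "T (u - v) + T v = T v" using lin(1)[of "u - v" v] uv by simp
    then have "T (u - v) = 0" by simp
    then have "\<delta> * norm (u - v) \<le> 0" using below[of "u - v"] by simp
    then show "u = v" using \<open>\<delta> > 0\<close> by (simp add: mult_le_0_iff)
  qed
  define G where "G = inv_into UNIV T"
  have inv: "G (T v) = v" "T (G v) = v" for v
    using \<open>inj T\<close> surj by (simp_all add: G_def surj_f_inv_f)
  define R where "R u = of_l2 (G (to_l2 u))" for u
  have R: "R (of_l2 v) = of_l2 (G v)" for v by (simp add: R_def)
  have "bounded_operator R"
    unfolding bounded_operator_def
  proof (intro conjI ballI allI)
    show "R u \<in> ell2ZZ" for u by (simp add: R_def)
    show "R (\<lambda>q r. u q r + v q r) = (\<lambda>q r. R u q r + R v q r)" if "u \<in> ell2ZZ" "v \<in> ell2ZZ" for u v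
    proof -
      have "G (to_l2 u + to_l2 v) = G (to_l2 u) + G (to_l2 v)"
        using inv lin(1) by metis
      then show ?thesis
        using R[of "to_l2 u + to_l2 v"] that by (simp add: R_def of_l2_add of_l2_to_l2)
    qed
    show "R (\<lambda>q r. x * u q r) = (\<lambda>q r. x * R u q r)" if "u \<in> ell2ZZ" for u x
    proof -
      have "G (cscale x (to_l2 u)) = cscale x (G (to_l2 u))"
        using inv lin(2) by metis
      then show ?thesis
        using R[of "cscale x (to_l2 u)"] that by (simp add: R_def of_l2_cscale of_l2_to_l2)
    qed
    show "\<exists>C. \<forall>u\<in>ell2ZZ. norm_ell2ZZ (R u) \<le> C * norm_ell2ZZ u"
    proof (intro exI ballI)
      fix u assume u: "u \<in> ell2ZZ"
      have "\<delta> * norm (G (to_l2 u)) \<le> norm (to_l2 u)"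
        using below[of "G (to_l2 u)"] inv by simp
      then show "norm_ell2ZZ (R u) \<le> (1 / \<delta>) * norm_ell2ZZ u"
        using \<open>\<delta> > 0\<close> norm_of_l2[of "to_l2 u"] u
        by (simp add: R_def norm_of_l2 of_l2_to_l2 field_simps)
    qed
  qed
  moreover have "R (shifted_operator S z u) = u \<and> shifted_operator S z (R u) = u" if "u \<in> ell2ZZ" for u
    using T[of "to_l2 u"] T[of "G (to_l2 u)"] that inv
    by (simp add: R_def of_l2_to_l2)
  ultimately show ?thesis unfolding operator_spectrum_def by blast
qed

lemma bounded_below_if_not_in_spectrum:
  assumes T: "\<And>v. shifted_operator S z (of_l2 v) = of_l2 (T v)"
    and "z \<notin> operator_spectrum S"
  obtains C where "C > 0" and "\<And>v. norm v \<le> C * norm (T v)"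
proof -
  obtain R C where C: "\<And>u. u \<in> ell2ZZ \<Longrightarrow> norm_ell2ZZ (R u) \<le> C * norm_ell2ZZ u"
    and R: "\<And>u. u \<in> ell2ZZ \<Longrightarrow> R (shifted_operator S z u) = u"
    using assms(2) unfolding operator_spectrum_def bounded_operator_def by blast
  have "norm v \<le> max C 1 * norm (T v)" for v
  proof -
    have "norm v = norm_ell2ZZ (R (of_l2 (T v)))"
      using R[of "of_l2 v"] T by (simp add: norm_of_l2)
    also have "\<dots> \<le> C * norm (T v)"
      using C[of "of_l2 (T v)"] by (simp add: norm_of_l2)
    also have "\<dots> \<le> max C 1 * norm (T v)" by (intro mult_right_mono) auto
    finally show ?thesis .
  qed
  then show thesis using that[of "max C 1"] by simp
qed

section \<open>The Jacobi-block-Jacobi operator as a finite-range operator\<close>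

text \<open>\<open>J\<close> couples a site only to itself and its eight neighbours.\<close>

definition nbhd :: "(int \<times> int) set" where "nbhd = {-1, 0, 1} \<times> {-1, 0, 1}"

definition jacobi_coeff :: "(int \<Rightarrow> real) \<Rightarrow> (int \<Rightarrow> complex) \<Rightarrow> int \<Rightarrow> int \<Rightarrow> complex" where
  "jacobi_coeff d e t r =
     (if t = 0 then complex_of_real (d r) else if t = 1 then e r else cnj (e (r - 1)))"

text \<open>The coefficients of \<open>J - z\<close>; the spectral parameter is built in because all estimates concern the shifted
  operator.\<close>

definition jbj_coeff ::
    "(int \<Rightarrow> int \<Rightarrow> real) \<Rightarrow> (int \<Rightarrow> int \<Rightarrow> complex) \<Rightarrow>
     (int \<Rightarrow> int \<Rightarrow> real) \<Rightarrow> (int \<Rightarrow> int \<Rightarrow> complex) \<Rightarrow> complex \<Rightarrow>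
     int \<times> int \<Rightarrow> int \<times> int \<Rightarrow> complex" where
  "jbj_coeff a \<alpha> c b z = (\<lambda>(s, t) (q, r).
     (if s = 0 then jacobi_coeff (c q) (b q) t r
      else if s = 1 then jacobi_coeff (a q) (\<alpha> q) t r
      else jacobi_coeff (a (q - 1)) (\<alpha> (q - 1)) t r)
     - (if s = 0 \<and> t = 0 then z else 0))"

lemma shifted_jbj_eq_finite_range_op:
  "shifted_operator (jacobi_block_jacobi a \<alpha> c b) z (\<lambda>q r. w (q, r)) q r
     = finite_range_op nbhd (jbj_coeff a \<alpha> c b z) w (q, r)"
  unfolding finite_range_op_def nbhd_def sum.cartesian_product[symmetric]
  by (simp add: shifted_operator_def jacobi_block_jacobi_def jacobi_op_def jbj_coeff_def
      jacobi_coeff_def algebra_simps)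

lemma uminus_nbhd: "uminus ` nbhd = nbhd"
proof -
  have "- s \<in> nbhd" if "s \<in> nbhd" for s using that by (auto simp: nbhd_def)
  then show ?thesis by (metis (no_types, lifting) image_eqI image_subset_iff minus_minus subsetI subset_antisym)
qed

text \<open>This expresses that \<open>J\<close> is symmetric: the adjoint of \<open>J - z\<close> is \<open>J - cnj z\<close>.\<close>

lemma jbj_coeff_adjoint:
  assumes "s \<in> nbhd"
  shows "jbj_coeff a \<alpha> c b (cnj z) s i = cnj (jbj_coeff a \<alpha> c b z (- s) (i + s))"
  using assms by (cases i) (auto simp: nbhd_def jbj_coeff_def jacobi_coeff_def)

lemma doubly_periodic_bounded:
  fixes w :: "int \<Rightarrow> int \<Rightarrow> 'a::real_normed_vector"
  assumes "doubly_periodic p1 p2 w" and "p1 > 0" and "p2 > 0"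
  obtains K where "\<And>q r. norm (w q r) \<le> K"
proof -
  let ?N = "(\<lambda>(q, r). norm (w q r)) ` ({0..<int p1} \<times> {0..<int p2})"
  have "norm (w q r) \<le> Max ?N" for q r
  proof (rule Max_ge)
    have "w q r = w (q mod int p1) (r mod int p2)"
      using assms(1)[unfolded doubly_periodic_def, rule_format, of "q mod int p1" "q div int p1" "r mod int p2" "r div int p2"]
      by simp
    then show "norm (w q r) \<in> ?N"
      using assms(2,3) by (auto intro!: image_eqI[where x = "(q mod int p1, r mod int p2)"])
  qed simp
  then show thesis using that by blast
qed

lemma jbj_coeff_bounded:
  assumes "p1 > 0" and "p2 > 0"
    and "doubly_periodic p1 p2 a" and "doubly_periodic p1 p2 \<alpha>"
    and "doubly_periodic p1 p2 c" and "doubly_periodic p1 p2 b"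
  obtains K where "\<And>s i. cmod (jbj_coeff a \<alpha> c b z s i) \<le> K"
proof -
  obtain Ka K\<alpha> Kc Kb where K: "\<And>q r. norm (a q r) \<le> Ka" "\<And>q r. norm (\<alpha> q r) \<le> K\<alpha>"
    "\<And>q r. norm (c q r) \<le> Kc" "\<And>q r. norm (b q r) \<le> Kb"
    using assms by (metis doubly_periodic_bounded)
  have nonneg: "0 \<le> Ka" "0 \<le> K\<alpha>" "0 \<le> Kc" "0 \<le> Kb"
    using K[of 0 0] by (auto intro: order_trans[OF norm_ge_zero])
  have jac: "cmod (jacobi_coeff (a q) (\<alpha> q) t r) \<le> Ka + K\<alpha> + Kc + Kb"
    "cmod (jacobi_coeff (c q) (b q) t r) \<le> Ka + K\<alpha> + Kc + Kb" for q t r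
    using K(1)[of q r] K(2)[of q r] K(2)[of q "r - 1"] K(3)[of q r] K(4)[of q r] K(4)[of q "r - 1"] nonneg
    by (auto simp: jacobi_coeff_def)
  have "cmod (jbj_coeff a \<alpha> c b z s i) \<le> (Ka + K\<alpha> + Kc + Kb) + cmod z" for s i
    unfolding jbj_coeff_def case_prod_unfold
    by (rule order_trans[OF norm_triangle_ineq4 add_mono]) (simp_all add: jac)
  then show thesis using that by blast
qed

section \<open>The symbol on Bloch functions\<close>

lemma sum_div_mod:
  fixes f :: "nat \<Rightarrow> nat \<Rightarrow> 'a::comm_monoid_add"
  shows "(\<Sum>k<m * n. f (k div n) (k mod n)) = (\<Sum>i<m. \<Sum>j<n. f i j)"
proof (cases "n = 0")
  case False
  have "(\<Sum>k<m * n. f (k div n) (k mod n)) = (\<Sum>(i, j)\<in>{..<m} \<times> {..<n}. f i j)"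
  proof (rule sum.reindex_bij_witness[where i = "\<lambda>(i, j). i * n + j" and j = "\<lambda>k. (k div n, k mod n)"])
    fix ij assume "ij \<in> {..<m} \<times> {..<n}"
    then obtain i j where ij: "ij = (i, j)" "i < m" "j < n" by auto
    have "i * n + j < Suc i * n" using \<open>j < n\<close> by simp
    also have "\<dots> \<le> m * n" using \<open>i < m\<close> by (intro mult_right_mono) auto
    finally show "(case ij of (i, j) \<Rightarrow> i * n + j) \<in> {..<m * n}" using ij by simp
  qed (use False in \<open>auto simp: less_mult_imp_div_less\<close>)
  then show ?thesis by (simp add: sum.cartesian_product)
qed simp

text \<open>A row of a cyclic tridiagonal matrix has three entries, of which one lies in a corner in the
  first and in the last row. The lemma serves twice: for the entries of a Jacobi symbol, and for the blocks
  of the full symbol. It requires \<open>3 \<le> n\<close> since for \<open>n = 2\<close> the corner entries coincide with the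
  off-diagonal ones.\<close>

lemma sum_cyclic_tridiagonal:
  fixes A B C U V :: "int \<Rightarrow> 'a::comm_monoid_add" and n :: nat
  assumes "3 \<le> n" and r: "1 \<le> r" "r \<le> int n"
    and f: "\<And>s. f s = (if r = s then A s else if s = r + 1 then B s else if r = s + 1 then C s
              else if r = 1 \<and> s = int n then U s else if r = int n \<and> s = 1 then V s else 0)"
  shows "(\<Sum>l<n. f (int l + 1)) =
      A r + (if r = int n then V 1 else B (r + 1)) + (if r = 1 then U (int n) else C (r - 1))"
proof -
  have "(\<Sum>l<n. f (int l + 1)) = (\<Sum>s\<in>{1..int n}. f s)"
    by (rule sum.reindex_bij_witness[where i = "\<lambda>s. nat (s - 1)" and j = "\<lambda>l. int l + 1"]) auto
  also have "\<dots> = (\<Sum>s\<in>{1..int n}. (if s = r then A s else 0)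
      + (if s = (if r = int n then 1 else r + 1) then (if r = int n then V s else B s) else 0)
      + (if s = (if r = 1 then int n else r - 1) then (if r = 1 then U s else C s) else 0))"
    using assms by (intro sum.cong) (auto simp: f)
  also have "\<dots> = A r + (if r = int n then V 1 else B (r + 1)) + (if r = 1 then U (int n) else C (r - 1))"
    using assms by (auto simp: sum.distrib)
  finally show ?thesis .
qed

lemma jacobi_symbol_carrier [simp]: "jacobi_symbol n d e x \<in> carrier_mat n n"
  by (auto simp: jacobi_symbol_def mat_of_rows_list_def)

lemma dim_jacobi_symbol [simp]:
  "dim_row (jacobi_symbol n d e x) = n" "dim_col (jacobi_symbol n d e x) = n"
  by (rule carrier_matD[OF jacobi_symbol_carrier])+

text \<open>The corner entries of the symbol account for the two neighbours that lie outside the period: their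
  values are those at the opposite end, up to a phase.\<close>

lemma jacobi_symbol_mult_bloch:
  assumes "2 \<le> n" and "i < n" and e: "e 0 = e (int n)"
    and v: "v 0 = cis x * v (int n)" "v (int n + 1) = cis (- x) * v 1"
  shows "(\<Sum>l<n. jacobi_symbol n d e x $$ (i, l) * v (int l + 1)) = jacobi_op d e v (int i + 1)"
proof (cases "n = 2")
  case True
  then have "i = 0 \<or> i = 1" using \<open>i < n\<close> by auto
  then show ?thesis
    using True e v
    by (auto simp: jacobi_symbol_def mat_of_rows_list_def jacobi_op_def numeral_2_eq_2 algebra_simps)
next
  case False
  define r where "r = int i + 1"
  have r: "1 \<le> r" "r \<le> int n" using \<open>i < n\<close> by (auto simp: r_def)
  define f where "f s = (if r = s then complex_of_real (d r) * v s else if s = r + 1 then e r * v s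
      else if r = s + 1 then cnj (e s) * v s
      else if r = 1 \<and> s = int n then cis x * cnj (e (int n)) * v s
      else if r = int n \<and> s = 1 then cis (- x) * e (int n) * v s else 0)" for s
  have "(\<Sum>l<n. jacobi_symbol n d e x $$ (i, l) * v (int l + 1)) = (\<Sum>l<n. f (int l + 1))"
    using False \<open>i < n\<close> by (intro sum.cong) (auto simp: jacobi_symbol_def f_def r_def Let_def)
  also have "\<dots> = complex_of_real (d r) * v r
      + (if r = int n then cis (- x) * e (int n) * v 1 else e r * v (r + 1))
      + (if r = 1 then cis x * cnj (e (int n)) * v (int n) else cnj (e (r - 1)) * v (r - 1))"
    using False assms(1) r by (intro sum_cyclic_tridiagonal) (auto simp: f_def)
  also have "\<dots> = jacobi_op d e v r"
    using e v by (auto simp: jacobi_op_def algebra_simps)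
  finally show ?thesis by (simp add: r_def)
qed

definition bloch :: "nat \<Rightarrow> nat \<Rightarrow> real \<Rightarrow> real \<Rightarrow> (int \<Rightarrow> int \<Rightarrow> complex) \<Rightarrow> bool" where
  "bloch p1 p2 x1 x2 w \<longleftrightarrow>
     (\<forall>q r. w (q + int p1) r = cis (- x1) * w q r \<and> w q (r + int p2) = cis (- x2) * w q r)"

text \<open>Block number and position inside the block are quotient and remainder of the index, as in
  \<open>block_matrix\<close>; the period cell starts at the index 1.\<close>

definition cell_vec :: "nat \<Rightarrow> nat \<Rightarrow> (int \<Rightarrow> int \<Rightarrow> complex) \<Rightarrow> complex vec" where
  "cell_vec p1 p2 w = vec (p1 * p2) (\<lambda>k. w (int (k div p2) + 1) (int (k mod p2) + 1))"

lemma dim_cell_vec [simp]: "dim_vec (cell_vec p1 p2 w) = p1 * p2"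
  by (simp add: cell_vec_def)

lemma jbj_symbol_carrier: "jbj_symbol p1 p2 a \<alpha> c b x1 x2 \<in> carrier_mat (p1 * p2) (p1 * p2)"
  by (simp add: jbj_symbol_def block_matrix_def)

lemma dim_jbj_symbol [simp]:
  "dim_row (jbj_symbol p1 p2 a \<alpha> c b x1 x2) = p1 * p2"
  "dim_col (jbj_symbol p1 p2 a \<alpha> c b x1 x2) = p1 * p2"
  by (rule carrier_matD[OF jbj_symbol_carrier])+

lemma jacobi_op_mult: "jacobi_op d e (\<lambda>r. z * v r) r = z * jacobi_op d e v r"
  by (simp add: jacobi_op_def algebra_simps)

lemma doubly_periodic_origin:
  assumes "doubly_periodic p1 p2 w"
  shows "w 0 r = w (int p1) r" and "w q 0 = w q (int p2)"
  using assms[unfolded doubly_periodic_def, rule_format, of 0 1 r 0]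
    assms[unfolded doubly_periodic_def, rule_format, of q 0 0 1] by auto

text \<open>Multiplication by one row of blocks is a cyclic tridiagonal sum whose terms are one-dimensional Jacobi
  operators, to which \<open>jacobi_symbol_mult_bloch\<close> applies with the phase \<open>x2\<close>. The corner blocks wrap
  around with the phase \<open>x1\<close>.\<close>

lemma jbj_symbol_mult_bloch:
  assumes p: "2 \<le> p1" "2 \<le> p2"
    and per: "doubly_periodic p1 p2 a" "doubly_periodic p1 p2 \<alpha>"
      "doubly_periodic p1 p2 c" "doubly_periodic p1 p2 b"
    and w: "bloch p1 p2 x1 x2 w"
  shows "jbj_symbol p1 p2 a \<alpha> c b x1 x2 *\<^sub>v cell_vec p1 p2 w
       = cell_vec p1 p2 (jacobi_block_jacobi a \<alpha> c b w)"
proof -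
  define A where "A n = jacobi_symbol p2 (a n) (\<alpha> n) x2" for n
  define B where "B n = jacobi_symbol p2 (c n) (b n) x2" for n
  define F where "F = (if p1 = 2 then
              (\<lambda>n m. if n = m then B n
                     else if n < m then A 1 + cis x1 \<cdot>\<^sub>m A 2
                     else A 1 + cis (- x1) \<cdot>\<^sub>m A 2)
            else
              (\<lambda>n m. if n = m then B n
                     else if m = n + 1 then A n
                     else if n = m + 1 then A m
                     else if n = 1 \<and> m = int p1 then cis x1 \<cdot>\<^sub>m A (int p1)
                     else if n = int p1 \<and> m = 1 then cis (- x1) \<cdot>\<^sub>m A (int p1)
                     else 0\<^sub>m p2 p2))"
  have S: "jbj_symbol p1 p2 a \<alpha> c b x1 x2 = block_matrix p1 p2 F"
    unfolding jbj_symbol_def F_def A_def B_def Let_def by (rule refl)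
  have dims [simp]: "dim_row (A n) = p2" "dim_col (A n) = p2" "dim_row (B n) = p2" "dim_col (B n) = p2" for n
    by (simp_all add: A_def B_def)
  have bl: "w (q + int p1) r = cis (- x1) * w q r" "w q (r + int p2) = cis (- x2) * w q r" for q r
    using w by (simp_all add: bloch_def)
  have cis_cancel: "cis x * (cis (- x) * z) = z" for x z
    by (simp add: cis_mult flip: mult.assoc)
  have w1: "w 0 r = cis x1 * w (int p1) r" "w (int p1 + 1) r = cis (- x1) * w 1 r" for r
    using bl(1)[of 0 r] bl(1)[of 1 r] by (simp_all add: add.commute cis_cancel)
  have w2: "w q 0 = cis x2 * w q (int p2)" "w q (int p2 + 1) = cis (- x2) * w q 1" for q
    using bl(2)[of q 0] bl(2)[of q 1] by (simp_all add: add.commute cis_cancel)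
  have A: "(\<Sum>l<p2. A n $$ (t, l) * w q (int l + 1)) = jacobi_op (a n) (\<alpha> n) (w q) (int t + 1)"
    and B: "(\<Sum>l<p2. B n $$ (t, l) * w q (int l + 1)) = jacobi_op (c n) (b n) (w q) (int t + 1)"
    if "t < p2" for n q t
    unfolding A_def B_def using p w2 that per
    by (intro jacobi_symbol_mult_bloch; simp add: doubly_periodic_origin(2))+
  have row: "(\<Sum>m<p1. \<Sum>l<p2. F n (int m + 1) $$ (t, l) * w (int m + 1) (int l + 1))
      = jacobi_block_jacobi a \<alpha> c b w n (int t + 1)"
    if n: "1 \<le> n" "n \<le> int p1" and t: "t < p2" for n t
  proof -
    let ?Ja = "\<lambda>k q. jacobi_op (a k) (\<alpha> k) (w q) (int t + 1)"
    let ?Jc = "\<lambda>k q. jacobi_op (c k) (b k) (w q) (int t + 1)"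
    have "a 0 = a (int p1)" "\<alpha> 0 = \<alpha> (int p1)"
      using doubly_periodic_origin(1)[OF per(1)] doubly_periodic_origin(1)[OF per(2)] by auto
    then have wrap: "?Ja 0 0 = cis x1 * ?Ja (int p1) (int p1)"
      "?Ja k (int p1 + 1) = cis (- x1) * ?Ja k 1" for k
      using ext[of "w 0", OF w1(1)] ext[of "w (int p1 + 1)", OF w1(2)] by (simp_all add: jacobi_op_mult)
    define f where "f s = (\<Sum>l<p2. F n s $$ (t, l) * w s (int l + 1))" for s
    show ?thesis
    proof (cases "p1 = 2")
      case True
      have "f s = (if n = s then ?Jc n s
          else if n < s then ?Ja 1 s + cis x1 * ?Ja 2 s else ?Ja 1 s + cis (- x1) * ?Ja 2 s)" for s
        using True t
        by (simp add: f_def F_def A[symmetric] B[symmetric] sum_distrib_left distrib_right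
            sum.distrib mult.assoc)
      moreover have n12: "n = 1 \<or> n = 2" using True n by auto
      ultimately have "f 1 + f 2 = jacobi_block_jacobi a \<alpha> c b w n (int t + 1)"
        using True wrap(1) wrap(2)[of 2] n12 by (auto simp: jacobi_block_jacobi_def)
      moreover have "(\<Sum>m<p1. f (int m + 1)) = f 1 + f 2"
        using True by (simp add: numeral_2_eq_2)
      ultimately show ?thesis by (simp add: f_def)
    next
      case False
      have f: "f s = (if n = s then ?Jc n s else if s = n + 1 then ?Ja n s else if n = s + 1 then ?Ja s s
          else if n = 1 \<and> s = int p1 then cis x1 * ?Ja (int p1) s
          else if n = int p1 \<and> s = 1 then cis (- x1) * ?Ja (int p1) s else 0)" if "1 \<le> s" "s \<le> int p1" for s
        using False t
        by (simp add: f_def F_def A[symmetric] B[symmetric] sum_distrib_left mult.assoc)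
      have "(\<Sum>m<p1. f (int m + 1)) = (\<Sum>m<p1. (\<lambda>s. if n = s then ?Jc n s else if s = n + 1 then ?Ja n s
          else if n = s + 1 then ?Ja s s
          else if n = 1 \<and> s = int p1 then cis x1 * ?Ja (int p1) s
          else if n = int p1 \<and> s = 1 then cis (- x1) * ?Ja (int p1) s else 0) (int m + 1))"
        by (intro sum.cong refl) (simp add: f)
      also have "\<dots> = ?Jc n n
          + (if n = int p1 then cis (- x1) * ?Ja (int p1) 1 else ?Ja n (n + 1))
          + (if n = 1 then cis x1 * ?Ja (int p1) (int p1) else ?Ja (n - 1) (n - 1))"
        by (rule sum_cyclic_tridiagonal) (use False p n in auto)
      also have "\<dots> = jacobi_block_jacobi a \<alpha> c b w n (int t + 1)"
        using wrap(1) wrap(2)[of n] by (auto simp: jacobi_block_jacobi_def)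
      finally show ?thesis by (simp add: f_def)
    qed
  qed
  show ?thesis
  proof (rule eq_vecI)
    fix i assume "i < dim_vec (cell_vec p1 p2 (jacobi_block_jacobi a \<alpha> c b w))"
    then have i: "i < p1 * p2" by simp
    then have div: "i div p2 < p1" and md: "i mod p2 < p2"
      using p by (auto simp: less_mult_imp_div_less)
    have "(jbj_symbol p1 p2 a \<alpha> c b x1 x2 *\<^sub>v cell_vec p1 p2 w) $ i
        = (\<Sum>k<p1 * p2. F (int (i div p2) + 1) (int (k div p2) + 1) $$ (i mod p2, k mod p2)
              * w (int (k div p2) + 1) (int (k mod p2) + 1))"
      using i by (simp add: S block_matrix_def cell_vec_def scalar_prod_def atLeast0LessThan)
    also have "\<dots> = (\<Sum>m<p1. \<Sum>l<p2. F (int (i div p2) + 1) (int m + 1) $$ (i mod p2, l)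
              * w (int m + 1) (int l + 1))"
      by (rule sum_div_mod)
    also have "\<dots> = cell_vec p1 p2 (jacobi_block_jacobi a \<alpha> c b w) $ i"
      using row[of "int (i div p2) + 1" "i mod p2"] div md i by (simp add: cell_vec_def)
    finally show "(jbj_symbol p1 p2 a \<alpha> c b x1 x2 *\<^sub>v cell_vec p1 p2 w) $ i
        = cell_vec p1 p2 (jacobi_block_jacobi a \<alpha> c b w) $ i" .
  qed simp
qed

section \<open>Plancherel identity on a grid of phases\<close>

definition grid :: "nat \<Rightarrow> nat \<Rightarrow> real" where "grid N j = 2 * pi * real j / real N"

text \<open>Orthogonality of characters: for \<open>d \<noteq> 0\<close> this is a geometric sum of an \<open>N\<close>-th root of unity, which
  differs from 1 because of \<open>\<bar>d\<bar> < N\<close>.\<close>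

lemma sum_cis_grid:
  assumes "0 < N" and "\<bar>d\<bar> < int N"
  shows "(\<Sum>j<N. cis (grid N j * of_int d)) = (if d = 0 then of_nat N else 0)"
proof (cases "d = 0")
  case False
  define \<omega> where "\<omega> = cis (2 * pi * of_int d / real N)"
  have pow: "cis (grid N j * of_int d) = \<omega> ^ j" for j
    by (simp add: \<omega>_def grid_def Complex.DeMoivre mult_ac)
  define k where "k = nat \<bar>d\<bar>"
  have k: "k \<in> {..<N}" "0 \<in> {..<N}" "k \<noteq> 0" using assms False by (auto simp: k_def)
  have "inj_on (\<lambda>k. cis (2 * pi * real k / real N)) {..<N}"
    using Complex.bij_betw_roots_unity[OF \<open>0 < N\<close>] by (rule bij_betw_imp_inj_on)
  then have "cis (2 * pi * real k / real N) \<noteq> 1"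
    using inj_onD[of _ "{..<N}" k 0] k by fastforce
  moreover have "cis (2 * pi * real k / real N) = (if d > 0 then \<omega> else cnj \<omega>)"
    using False by (auto simp: k_def \<omega>_def cis_cnj)
  ultimately have "\<omega> \<noteq> 1" by (auto split: if_splits)
  moreover have "\<omega> ^ N = 1"
    using \<open>0 < N\<close> by (simp add: \<omega>_def Complex.DeMoivre)
  ultimately show ?thesis using False by (simp add: pow geometric_sum)
qed simp

text \<open>The frequencies in \<open>{-K..K}\<close> are distinct modulo \<open>N\<close>, so the grid of \<open>N\<close> points is fine enough to
  separate them, and the mixed terms of the squared sum cancel.\<close>

lemma discrete_plancherel:
  fixes f :: "int \<Rightarrow> complex"
  assumes "2 * K < N"
  shows "(\<Sum>j<N. (cmod (\<Sum>m\<in>{-int K..int K}. cis (grid N j * of_int m) * f m))\<^sup>2)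
       = real N * (\<Sum>m\<in>{-int K..int K}. (cmod (f m))\<^sup>2)"
proof -
  let ?I = "{-int K..int K}"
  have cis_diff: "cis (g * of_int (m - n)) = cis (g * of_int m) * cnj (cis (g * of_int n))" for g m n
    by (simp add: cis_cnj cis_mult right_diff_distrib)
  have "complex_of_real (\<Sum>j<N. (cmod (\<Sum>m\<in>?I. cis (grid N j * of_int m) * f m))\<^sup>2)
      = (\<Sum>j<N. \<Sum>m\<in>?I. \<Sum>n\<in>?I. cis (grid N j * of_int (m - n)) * (f m * cnj (f n)))"
    unfolding of_real_sum complex_norm_square cnj_sum sum_product cis_diff
    by (simp add: mult_ac)
  also have "\<dots> = (\<Sum>m\<in>?I. \<Sum>n\<in>?I. (\<Sum>j<N. cis (grid N j * of_int (m - n))) * (f m * cnj (f n)))"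
    by (subst sum.swap, intro sum.cong refl, subst sum.swap) (simp add: sum_distrib_right)
  also have "\<dots> = (\<Sum>m\<in>?I. \<Sum>n\<in>?I. if n = m then of_nat N * (f m * cnj (f m)) else 0)"
    using assms by (intro sum.cong refl, subst sum_cis_grid) auto
  also have "\<dots> = complex_of_real (real N * (\<Sum>m\<in>?I. (cmod (f m))\<^sup>2))"
    unfolding of_real_mult of_real_sum complex_norm_square by (simp add: sum_distrib_left)
  finally show ?thesis unfolding of_real_eq_iff .
qed

lemma discrete_plancherel_2d:
  fixes f :: "int \<times> int \<Rightarrow> complex"
  assumes "2 * K < N"
  shows "(\<Sum>j<N. \<Sum>l<N. (cmod (\<Sum>(m, n)\<in>{-int K..int K} \<times> {-int K..int K}.
            cis (of_int m * grid N j + of_int n * grid N l) * f (m, n)))\<^sup>2)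
       = (real N)\<^sup>2 * (\<Sum>i\<in>{-int K..int K} \<times> {-int K..int K}. (cmod (f i))\<^sup>2)"
proof -
  let ?I = "{-int K..int K}"
  have "(\<Sum>j<N. \<Sum>l<N. (cmod (\<Sum>(m, n)\<in>?I \<times> ?I.
            cis (of_int m * grid N j + of_int n * grid N l) * f (m, n)))\<^sup>2)
      = (\<Sum>l<N. \<Sum>j<N. (cmod (\<Sum>m\<in>?I. cis (grid N j * of_int m)
            * (\<Sum>n\<in>?I. cis (grid N l * of_int n) * f (m, n))))\<^sup>2)"
    by (subst sum.swap)
       (simp add: sum.cartesian_product[symmetric] sum_distrib_left cis_mult[symmetric] mult_ac)
  also have "\<dots> = (\<Sum>l<N. real N * (\<Sum>m\<in>?I. (cmod (\<Sum>n\<in>?I. cis (grid N l * of_int n) * f (m, n)))\<^sup>2))"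
    by (intro sum.cong refl discrete_plancherel assms)
  also have "\<dots> = real N * (\<Sum>m\<in>?I. \<Sum>l<N. (cmod (\<Sum>n\<in>?I. cis (grid N l * of_int n) * f (m, n)))\<^sup>2)"
    by (subst sum.swap) (simp add: sum_distrib_left)
  also have "\<dots> = real N * (\<Sum>m\<in>?I. real N * (\<Sum>n\<in>?I. (cmod (f (m, n)))\<^sup>2))"
    by (simp only: discrete_plancherel[OF assms])
  also have "\<dots> = (real N)\<^sup>2 * (\<Sum>i\<in>?I \<times> ?I. (cmod (f i))\<^sup>2)"
    by (simp add: sum.cartesian_product[symmetric] sum_distrib_left power2_eq_square mult.assoc
        sum.cartesian_product')
  finally show ?thesis .
qed

section \<open>Bloch sums\<close>

definition period_shift :: "nat \<Rightarrow> nat \<Rightarrow> int \<times> int \<Rightarrow> int \<times> int" where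
  "period_shift p1 p2 = (\<lambda>(m, n). (m * int p1, n * int p2))"

text \<open>The component of \<open>u\<close> with phase \<open>(x1, x2)\<close> in its decomposition into Bloch functions. It is only applied
  to functions of finite support, where the sum is finite for each \<open>i\<close>.\<close>

definition bloch_sum ::
    "nat \<Rightarrow> nat \<Rightarrow> real \<Rightarrow> real \<Rightarrow> (int \<times> int \<Rightarrow> complex) \<Rightarrow> int \<times> int \<Rightarrow> complex" where
  "bloch_sum p1 p2 x1 x2 u i =
     (\<Sum>\<^sub>\<infinity>(m, n). cis (of_int m * x1 + of_int n * x2) * u (i + period_shift p1 p2 (m, n)))"

lemma bloch_bloch_sum: "bloch p1 p2 x1 x2 (\<lambda>q r. bloch_sum p1 p2 x1 x2 u (q, r))"
  unfolding bloch_def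
proof (intro allI conjI)
  fix q r
  have "bloch_sum p1 p2 x1 x2 u (q + int p1, r)
      = (\<Sum>\<^sub>\<infinity>i\<in>UNIV. cis (- x1) * (case i of (m, n) \<Rightarrow>
           cis (of_int m * x1 + of_int n * x2) * u ((q, r) + period_shift p1 p2 (m, n))))"
    unfolding bloch_sum_def
    by (rule infsum_reindex_bij_witness[where j = "\<lambda>(m, n). (m + 1, n)" and i = "\<lambda>(m, n). (m - 1, n)"])
       (auto simp: period_shift_def algebra_simps cis_mult simp flip: mult.assoc)
  then show "bloch_sum p1 p2 x1 x2 u (q + int p1, r) = cis (- x1) * bloch_sum p1 p2 x1 x2 u (q, r)"
    by (simp only: infsum_cmult_right' bloch_sum_def)
  have "bloch_sum p1 p2 x1 x2 u (q, r + int p2)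
      = (\<Sum>\<^sub>\<infinity>i\<in>UNIV. cis (- x2) * (case i of (m, n) \<Rightarrow>
           cis (of_int m * x1 + of_int n * x2) * u ((q, r) + period_shift p1 p2 (m, n))))"
    unfolding bloch_sum_def
    by (rule infsum_reindex_bij_witness[where j = "\<lambda>(m, n). (m, n + 1)" and i = "\<lambda>(m, n). (m, n - 1)"])
       (auto simp: period_shift_def algebra_simps cis_mult simp flip: mult.assoc)
  then show "bloch_sum p1 p2 x1 x2 u (q, r + int p2) = cis (- x2) * bloch_sum p1 p2 x1 x2 u (q, r)"
    by (simp only: infsum_cmult_right' bloch_sum_def)
qed

lemma inj_period_shift: "0 < p1 \<Longrightarrow> 0 < p2 \<Longrightarrow> inj (period_shift p1 p2)"
  by (auto simp: period_shift_def inj_def)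

lemma infsum_sum_swap:
  fixes f :: "'a \<Rightarrow> 'b \<Rightarrow> 'c::{topological_comm_monoid_add, t2_space}"
  assumes "\<And>s. s \<in> D \<Longrightarrow> f s summable_on A"
  shows "(\<Sum>\<^sub>\<infinity>x\<in>A. \<Sum>s\<in>D. f s x) = (\<Sum>s\<in>D. infsum (f s) A)"
proof -
  have "(\<lambda>x. \<Sum>s\<in>D. f s x) summable_on A \<and> (\<Sum>\<^sub>\<infinity>x\<in>A. \<Sum>s\<in>D. f s x) = (\<Sum>s\<in>D. infsum (f s) A)"
    using assms
    by (induction D rule: infinite_finite_induct) (auto intro: summable_on_add simp: infsum_add)
  then show ?thesis ..
qed

text \<open>An operator with periodic coefficients commutes with translations by periods, and therefore with the
  decomposition into Bloch functions.\<close>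

lemma bloch_sum_finite_range_op:
  assumes "0 < p1" "0 < p2" and fin: "finite {i. u i \<noteq> 0}"
    and per: "\<And>s i g. s \<in> D \<Longrightarrow> c s (i + period_shift p1 p2 g) = c s i"
  shows "bloch_sum p1 p2 x1 x2 (finite_range_op D c u) i
       = finite_range_op D c (bloch_sum p1 p2 x1 x2 u) i"
proof -
  define \<epsilon> where "\<epsilon> = (\<lambda>(m, n). cis (of_int m * x1 + of_int n * x2))"
  have B: "bloch_sum p1 p2 x1 x2 v j = (\<Sum>\<^sub>\<infinity>g. \<epsilon> g * v (j + period_shift p1 p2 g))" for v j
    by (simp add: bloch_sum_def \<epsilon>_def case_prod_unfold)
  have summ: "(\<lambda>g. c s i * (\<epsilon> g * u (i + s + period_shift p1 p2 g))) summable_on UNIV" for s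
  proof -
    have "{g. u (i + s + period_shift p1 p2 g) \<noteq> 0} = (\<lambda>g. i + s + period_shift p1 p2 g) -` {i. u i \<noteq> 0}"
      by auto
    moreover have "inj (\<lambda>g. i + s + period_shift p1 p2 g)"
      using inj_period_shift[OF assms(1,2)] by (auto simp: inj_def)
    ultimately have "finite {g. u (i + s + period_shift p1 p2 g) \<noteq> 0}"
      using finite_vimageI[OF fin] by metis
    then have "(\<lambda>g. c s i * (\<epsilon> g * u (i + s + period_shift p1 p2 g))) summable_on {g. u (i + s + period_shift p1 p2 g) \<noteq> 0}"
      by simp
    then show ?thesis
      by (rule summable_on_cong_neutral[THEN iffD1, rotated -1]) auto
  qed
  have "bloch_sum p1 p2 x1 x2 (finite_range_op D c u) i
      = (\<Sum>\<^sub>\<infinity>g. \<Sum>s\<in>D. c s i * (\<epsilon> g * u (i + s + period_shift p1 p2 g)))"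
    unfolding B finite_range_op_def sum_distrib_left
    by (intro infsum_cong sum.cong refl) (simp add: per algebra_simps)
  also have "\<dots> = (\<Sum>s\<in>D. \<Sum>\<^sub>\<infinity>g. c s i * (\<epsilon> g * u (i + s + period_shift p1 p2 g)))"
    by (rule infsum_sum_swap[OF summ])
  also have "\<dots> = finite_range_op D c (bloch_sum p1 p2 x1 x2 u) i"
    by (simp add: finite_range_op_def B infsum_cmult_right')
  finally show ?thesis .
qed

definition cell_index :: "nat \<Rightarrow> nat \<Rightarrow> int \<times> int" where
  "cell_index p2 k = (int (k div p2) + 1, int (k mod p2) + 1)"

lemma bij_betw_cells:
  assumes "0 < p1" "0 < p2"
  shows "bij_betw (\<lambda>(k, g). cell_index p2 k + period_shift p1 p2 g) ({..<p1 * p2} \<times> UNIV) UNIV"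
proof (rule bij_betw_byWitness[where f' = "\<lambda>(q, r).
      (nat ((q - 1) mod int p1) * p2 + nat ((r - 1) mod int p2), ((q - 1) div int p1, (r - 1) div int p2))"])
  have bound: "nat ((q - 1) mod int p1) * p2 + nat ((r - 1) mod int p2) < p1 * p2" for q r
  proof -
    have "nat ((r - 1) mod int p2) < p2" "nat ((q - 1) mod int p1) < p1"
      using assms by (simp_all add: nat_less_iff)
    then have "nat ((q - 1) mod int p1) * p2 + nat ((r - 1) mod int p2) < Suc (nat ((q - 1) mod int p1)) * p2"
      by simp
    also have "\<dots> \<le> p1 * p2" using \<open>nat ((q - 1) mod int p1) < p1\<close> by (intro mult_right_mono) auto
    finally show ?thesis .
  qed
  then show "(\<lambda>(q, r). (nat ((q - 1) mod int p1) * p2 + nat ((r - 1) mod int p2),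
      ((q - 1) div int p1, (r - 1) div int p2))) ` UNIV \<subseteq> {..<p1 * p2} \<times> UNIV"
    by auto
  show "\<forall>x\<in>{..<p1 * p2} \<times> UNIV. (\<lambda>(q, r). (nat ((q - 1) mod int p1) * p2 + nat ((r - 1) mod int p2),
      ((q - 1) div int p1, (r - 1) div int p2)))
        ((\<lambda>(k, g). cell_index p2 k + period_shift p1 p2 g) x) = x"
  proof
    fix x :: "nat \<times> int \<times> int"
    assume "x \<in> {..<p1 * p2} \<times> UNIV"
    then obtain k m n where x: "x = (k, m, n)" "k < p1 * p2" by auto
    then have "int (k div p2) < int p1" "int (k mod p2) < int p2"
      using assms by (auto simp: less_mult_imp_div_less)
    then have "(int (k div p2) + m * int p1) mod int p1 = int (k div p2)"
      "(int (k div p2) + m * int p1) div int p1 = m"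
      "(int (k mod p2) + n * int p2) mod int p2 = int (k mod p2)"
      "(int (k mod p2) + n * int p2) div int p2 = n"
      by (simp_all del: of_nat_div of_nat_mod)
    then show "(\<lambda>(q, r). (nat ((q - 1) mod int p1) * p2 + nat ((r - 1) mod int p2),
      ((q - 1) div int p1, (r - 1) div int p2)))
        ((\<lambda>(k, g). cell_index p2 k + period_shift p1 p2 g) x) = x"
      by (simp add: x cell_index_def period_shift_def del: of_nat_div of_nat_mod)
  qed
  show "\<forall>y\<in>UNIV. (\<lambda>(k, g). cell_index p2 k + period_shift p1 p2 g) ((\<lambda>(q, r).
      (nat ((q - 1) mod int p1) * p2 + nat ((r - 1) mod int p2), ((q - 1) div int p1, (r - 1) div int p2))) y) = y"
    using assms by (auto simp: cell_index_def period_shift_def nat_less_iff)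
qed auto

text \<open>The translates of the period cell tile the plane.\<close>

lemma infsum_over_cells:
  fixes f :: "int \<times> int \<Rightarrow> real"
  assumes "0 < p1" "0 < p2" and "f summable_on UNIV"
  shows "infsum f UNIV = (\<Sum>k<p1 * p2. \<Sum>\<^sub>\<infinity>g. f (cell_index p2 k + period_shift p1 p2 g))"
proof -
  let ?\<phi> = "\<lambda>(k, g). cell_index p2 k + period_shift p1 p2 g"
  note bij = bij_betw_cells[OF assms(1,2)]
  have "infsum f UNIV = (\<Sum>\<^sub>\<infinity>x\<in>{..<p1 * p2} \<times> UNIV. f (?\<phi> x))"
    using infsum_reindex_bij_betw[OF bij, of f] by simp
  also have "\<dots> = (\<Sum>\<^sub>\<infinity>k\<in>{..<p1 * p2}. \<Sum>\<^sub>\<infinity>g. f (?\<phi> (k, g)))"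
    using summable_on_reindex_bij_betw[OF bij, of f] assms(3)
    by (subst infsum_Sigma_banach) auto
  finally show ?thesis by simp
qed

section \<open>Continuous families of matrices\<close>

lemma continuous_on_det:
  fixes M :: "'a::topological_space \<Rightarrow> complex mat"
  assumes M: "\<And>x. x \<in> X \<Longrightarrow> M x \<in> carrier_mat n n"
    and cont: "\<And>i j. i < n \<Longrightarrow> j < n \<Longrightarrow> continuous_on X (\<lambda>x. M x $$ (i, j))"
  shows "continuous_on X (\<lambda>x. det (M x))"
proof -
  have "continuous_on X (\<lambda>x. \<Sum>\<pi> | \<pi> permutes {0..<n}. signof \<pi> * (\<Prod>i = 0..<n. M x $$ (i, \<pi> i)))"
    by (intro continuous_intros cont) (auto simp: permutes_in_image)
  then show ?thesis
    by (rule continuous_on_eq) (simp add: det_def'[OF M])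
qed

lemma continuous_on_adj_mat:
  fixes M :: "'a::topological_space \<Rightarrow> complex mat"
  assumes M: "\<And>x. x \<in> X \<Longrightarrow> M x \<in> carrier_mat n n"
    and cont: "\<And>i j. i < n \<Longrightarrow> j < n \<Longrightarrow> continuous_on X (\<lambda>x. M x $$ (i, j))"
    and ij: "i < n" "j < n"
  shows "continuous_on X (\<lambda>x. adj_mat (M x) $$ (i, j))"
proof -
  have "continuous_on X (\<lambda>x. (- 1) ^ (j + i) * det (mat_delete (M x) j i))"
  proof (intro continuous_intros continuous_on_det)
    show "mat_delete (M x) j i \<in> carrier_mat (n - 1) (n - 1)" if "x \<in> X" for x
      using M[OF that] by (rule mat_delete_carrier)
    fix k l assume kl: "k < n - 1" "l < n - 1"
    have "continuous_on X (\<lambda>x. M x $$ (insert_index j k, insert_index i l))"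
      using kl ij by (intro cont) (auto simp: insert_index_def)
    then show "continuous_on X (\<lambda>x. mat_delete (M x) j i $$ (k, l))"
    proof (rule continuous_on_eq)
      fix x assume "x \<in> X"
      then show "M x $$ (insert_index j k, insert_index i l) = mat_delete (M x) j i $$ (k, l)"
        using mat_delete_index[of "M x" "n - 1" j i k l] M ij kl by simp
    qed
  qed
  then show ?thesis
    by (rule continuous_on_eq) (use carrier_matD[OF M] ij in \<open>simp add: adj_mat_def cofactor_def\<close>)
qed

lemma mult_mat_vec_norm_le:
  fixes A :: "complex mat"
  assumes "A \<in> carrier_mat m n" "v \<in> carrier_vec n"
  shows "(\<Sum>i<m. (cmod ((A *\<^sub>v v) $ i))\<^sup>2) \<le> (\<Sum>i<m. \<Sum>j<n. (cmod (A $$ (i, j)))\<^sup>2) * (\<Sum>j<n. (cmod (v $ j))\<^sup>2)"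
  unfolding sum_distrib_right
proof (rule sum_mono)
  fix i assume "i \<in> {..<m}"
  then have "(A *\<^sub>v v) $ i = (\<Sum>j<n. A $$ (i, j) * v $ j)"
    using assms by (auto simp: scalar_prod_def atLeast0LessThan)
  then have "cmod ((A *\<^sub>v v) $ i) \<le> (\<Sum>j<n. cmod (A $$ (i, j)) * cmod (v $ j))"
    using norm_sum[of "\<lambda>j. A $$ (i, j) * v $ j" "{..<n}"] by (simp add: norm_mult)
  then have "(cmod ((A *\<^sub>v v) $ i))\<^sup>2 \<le> (\<Sum>j<n. cmod (A $$ (i, j)) * cmod (v $ j))\<^sup>2"
    by (intro power_mono) auto
  also have "\<dots> \<le> (\<Sum>j<n. (cmod (A $$ (i, j)))\<^sup>2) * (\<Sum>j<n. (cmod (v $ j))\<^sup>2)"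
    by (rule Cauchy_Schwarz_ineq_sum)
  finally show "(cmod ((A *\<^sub>v v) $ i))\<^sup>2
      \<le> (\<Sum>ia<n. (cmod (A $$ (i, ia)))\<^sup>2 * (\<Sum>j<n. (cmod (v $ j))\<^sup>2))"
    by (simp add: sum_distrib_right)
qed

text \<open>By Cramer's rule the inverse of \<open>M x\<close> is its adjugate divided by its determinant. The sum of the squared
  moduli of its entries depends continuously on \<open>x\<close>, hence is bounded on \<open>X\<close>, and it bounds the
  square of the operator norm of the inverse.\<close>

lemma invertible_family_bounded_below:
  fixes M :: "'a::topological_space \<Rightarrow> complex mat"
  assumes "compact X" and M: "\<And>x. x \<in> X \<Longrightarrow> M x \<in> carrier_mat n n"
    and cont: "\<And>i j. i < n \<Longrightarrow> j < n \<Longrightarrow> continuous_on X (\<lambda>x. M x $$ (i, j))"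
    and det: "\<And>x. x \<in> X \<Longrightarrow> det (M x) \<noteq> 0"
  obtains \<delta> where "\<delta> > 0"
    and "\<And>x v. x \<in> X \<Longrightarrow> v \<in> carrier_vec n \<Longrightarrow>
           \<delta> * (\<Sum>i<n. (cmod (v $ i))\<^sup>2) \<le> (\<Sum>i<n. (cmod ((M x *\<^sub>v v) $ i))\<^sup>2)"
proof -
  \<comment> \<open>The squared Frobenius norm of the inverse of \<open>M x\<close>.\<close>
  define h where "h x = (\<Sum>i<n. \<Sum>j<n. (cmod (adj_mat (M x) $$ (i, j)))\<^sup>2) / (cmod (det (M x)))\<^sup>2" for x
  have "continuous_on X h"
    unfolding h_def
    by (intro continuous_intros continuous_on_adj_mat continuous_on_det M cont) (simp_all add: det M)
  then have "bounded (h ` X)"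
    using \<open>compact X\<close> by (simp add: compact_continuous_image compact_imp_bounded)
  then obtain B where "\<And>x. x \<in> X \<Longrightarrow> norm (h x) \<le> B"
    by (auto simp: bounded_iff)
  then have B: "h x \<le> max B 1" if "x \<in> X" for x using that by (force simp: max_def)
  have "1 / max B 1 * (\<Sum>i<n. (cmod (v $ i))\<^sup>2) \<le> (\<Sum>i<n. (cmod ((M x *\<^sub>v v) $ i))\<^sup>2)"
    if x: "x \<in> X" and v: "v \<in> carrier_vec n" for x v
  proof -
    note adj = adj_mat[OF M[OF x]]
    let ?w = "M x *\<^sub>v v"
    have w: "?w \<in> carrier_vec n" using M[OF x] v by auto
    have "adj_mat (M x) *\<^sub>v ?w = (det (M x) \<cdot>\<^sub>m 1\<^sub>m n) *\<^sub>v v"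
      using assoc_mult_mat_vec[OF adj(1) M[OF x] v] by (simp add: adj(3))
    also have "\<dots> = det (M x) \<cdot>\<^sub>v v"
      using v by (intro eq_vecI) (simp_all add: row_smult smult_scalar_prod_distrib[of _ n])
    finally have "adj_mat (M x) *\<^sub>v ?w = det (M x) \<cdot>\<^sub>v v" .
    then have "(cmod (det (M x)))\<^sup>2 * (\<Sum>i<n. (cmod (v $ i))\<^sup>2) = (\<Sum>i<n. (cmod ((adj_mat (M x) *\<^sub>v ?w) $ i))\<^sup>2)"
      using v by (simp add: norm_mult power_mult_distrib sum_distrib_left)
    also have "\<dots> \<le> (\<Sum>i<n. \<Sum>j<n. (cmod (adj_mat (M x) $$ (i, j)))\<^sup>2) * (\<Sum>i<n. (cmod (?w $ i))\<^sup>2)"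
      by (rule mult_mat_vec_norm_le[OF adj(1) w])
    finally have "(\<Sum>i<n. (cmod (v $ i))\<^sup>2) \<le> h x * (\<Sum>i<n. (cmod (?w $ i))\<^sup>2)"
      using det[OF x] by (simp add: h_def field_simps)
    also have "\<dots> \<le> max B 1 * (\<Sum>i<n. (cmod (?w $ i))\<^sup>2)"
      by (intro mult_right_mono B x sum_nonneg) auto
    finally show ?thesis by (simp add: field_simps)
  qed
  then show thesis using that[of "1 / max B 1"] by simp
qed

lemma continuous_on_if_const:
  "(P \<Longrightarrow> continuous_on X f) \<Longrightarrow> (\<not> P \<Longrightarrow> continuous_on X g) \<Longrightarrow>
    continuous_on X (\<lambda>x. if P then f x else g x)"
  by (cases P) simp_all

lemma continuous_on_jbj_symbol:
  assumes "i < p1 * p2" "j < p1 * p2"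
  shows "continuous_on X (\<lambda>x. jbj_symbol p1 p2 a \<alpha> c b (fst x) (snd x) $$ (i, j))"
proof -
  have entry: "continuous_on X (\<lambda>x. jacobi_symbol p2 d e (snd x) $$ (k, l))" if "k < p2" "l < p2" for d e k l
  proof (cases "p2 = 2")
    case True
    then have "k = 0 \<or> k = 1" "l = 0 \<or> l = 1" using that by auto
    then show ?thesis using True
      by (auto simp: jacobi_symbol_def mat_of_rows_list_def intro!: continuous_intros)
  next
    case False
    then show ?thesis using that
      by (simp add: jacobi_symbol_def Let_def) (intro continuous_on_if_const continuous_intros)
  qed
  have bounds: "j div p2 < p1" "i div p2 < p1" "j mod p2 < p2" "i mod p2 < p2"
    using assms by (auto simp: less_mult_imp_div_less intro!: mod_less_divisor gr0I)
  show ?thesis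
    using assms bounds
    by (simp add: jbj_symbol_def block_matrix_def Let_def if_distrib[of "\<lambda>A. A $$ _"] if_distribR
        del: of_nat_div of_nat_mod cong: if_cong)
       (intro conjI impI continuous_on_if_const continuous_intros entry; simp)
qed

section \<open>Non-eigenvalues of the symbol are not in the spectrum\<close>

text \<open>A function that vanishes outside a box of radius \<open>M\<close> meets only finitely many translates of the cell, and
  their number can be bounded independently of the periods.\<close>

lemma cell_window:
  assumes "k < p1 * p2" and "\<bar>fst (cell_index p2 k + period_shift p1 p2 (m, n))\<bar> \<le> int M"
    and "\<bar>snd (cell_index p2 k + period_shift p1 p2 (m, n))\<bar> \<le> int M"
  shows "\<bar>m\<bar> \<le> int M + 1 \<and> \<bar>n\<bar> \<le> int M + 1"
proof -
  have window: "\<bar>m\<bar> \<le> int M + 1" if "0 \<le> q" "q < int l" "\<bar>q + 1 + m * int l\<bar> \<le> int M" for q m :: int and l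
  proof (rule ccontr)
    assume "\<not> \<bar>m\<bar> \<le> int M + 1"
    then consider "int M + 2 \<le> m" | "m + 1 \<le> - (int M + 1)" by linarith
    then show False
    proof cases
      case 1
      then have "m * 1 \<le> m * int l" using that by (intro mult_left_mono) auto
      then show False using 1 that by linarith
    next
      case 2
      then have "(m + 1) * int l \<le> (m + 1) * 1" using that by (intro mult_left_mono_neg) auto
      then show False using 2 that by (simp add: distrib_right)
    qed
  qed
  have "k div p2 < p1" "k mod p2 < p2"
    using assms(1) by (auto simp: less_mult_imp_div_less intro!: mod_less_divisor gr0I)
  then show ?thesis
    using assms(2,3) window[of "int (k div p2)" p1 m] window[of "int (k mod p2)" p2 n]
    by (simp add: cell_index_def period_shift_def del: of_nat_div of_nat_mod)
qed

text \<open>The discrete Plancherel identity applies for each site \<open>k\<close> of the cell to the values of \<open>f\<close> on the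
  translates of that site. The condition on \<open>N\<close> lets one grid serve all sites.\<close>

lemma bloch_plancherel:
  fixes f :: "int \<times> int \<Rightarrow> complex"
  assumes p: "0 < p1" "0 < p2" and supp: "\<And>i. f i \<noteq> 0 \<Longrightarrow> \<bar>fst i\<bar> \<le> int M \<and> \<bar>snd i\<bar> \<le> int M"
    and N: "2 * (M + 1) < N"
  shows "(\<Sum>j<N. \<Sum>l<N. \<Sum>k<p1 * p2. (cmod (bloch_sum p1 p2 (grid N j) (grid N l) f (cell_index p2 k)))\<^sup>2)
       = (real N)\<^sup>2 * (\<Sum>\<^sub>\<infinity>i. (cmod (f i))\<^sup>2)"
proof -
  let ?I = "{-int (M + 1)..int (M + 1)} \<times> {-int (M + 1)..int (M + 1)}"
  have zero: "f (cell_index p2 k + period_shift p1 p2 g) = 0" if "k < p1 * p2" "g \<notin> ?I" for k g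
  proof (rule ccontr)
    assume "f (cell_index p2 k + period_shift p1 p2 g) \<noteq> 0"
    then show False
      using supp[of "cell_index p2 k + period_shift p1 p2 g"] cell_window[OF that(1), of "fst g" "snd g" M] that(2)
      by (cases g) auto
  qed
  have cell: "(\<Sum>j<N. \<Sum>l<N. (cmod (bloch_sum p1 p2 (grid N j) (grid N l) f (cell_index p2 k)))\<^sup>2)
      = (real N)\<^sup>2 * (\<Sum>\<^sub>\<infinity>g. (cmod (f (cell_index p2 k + period_shift p1 p2 g)))\<^sup>2)" if k: "k < p1 * p2" for k
  proof -
    have "bloch_sum p1 p2 x1 x2 f (cell_index p2 k) = (\<Sum>(m, n)\<in>?I.
        cis (of_int m * x1 + of_int n * x2) * f (cell_index p2 k + period_shift p1 p2 (m, n)))" for x1 x2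
    proof -
      have "bloch_sum p1 p2 x1 x2 f (cell_index p2 k) = (\<Sum>\<^sub>\<infinity>(m, n)\<in>?I.
          cis (of_int m * x1 + of_int n * x2) * f (cell_index p2 k + period_shift p1 p2 (m, n)))"
        unfolding bloch_sum_def by (rule infsum_cong_neutral) (use zero[OF k] in force)+
      then show ?thesis by simp
    qed
    moreover have "(\<Sum>\<^sub>\<infinity>g. (cmod (f (cell_index p2 k + period_shift p1 p2 g)))\<^sup>2)
        = (\<Sum>\<^sub>\<infinity>g\<in>?I. (cmod (f (cell_index p2 k + period_shift p1 p2 g)))\<^sup>2)"
      by (rule infsum_cong_neutral) (use zero[OF k] in force)+
    ultimately show ?thesis
      using discrete_plancherel_2d[OF N, of "\<lambda>g. f (cell_index p2 k + period_shift p1 p2 g)"] by simp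
  qed
  have summ: "(\<lambda>i. (cmod (f i))\<^sup>2) summable_on UNIV"
  proof -
    have "(\<lambda>i. (cmod (f i))\<^sup>2) summable_on {-int M..int M} \<times> {-int M..int M}" by simp
    then show ?thesis
      by (rule summable_on_cong_neutral[THEN iffD1, rotated -1]) (use supp in fastforce)+
  qed
  have "(\<Sum>j<N. \<Sum>l<N. \<Sum>k<p1 * p2. (cmod (bloch_sum p1 p2 (grid N j) (grid N l) f (cell_index p2 k)))\<^sup>2)
      = (\<Sum>k<p1 * p2. \<Sum>j<N. \<Sum>l<N. (cmod (bloch_sum p1 p2 (grid N j) (grid N l) f (cell_index p2 k)))\<^sup>2)"
    by (subst sum.swap[of _ "{..<p1 * p2}"], subst (2) sum.swap) simp
  also have "\<dots> = (real N)\<^sup>2 * (\<Sum>\<^sub>\<infinity>i. (cmod (f i))\<^sup>2)"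
    by (simp add: cell infsum_over_cells[OF p summ] sum_distrib_left)
  finally show ?thesis .
qed

lemma doubly_periodic_shift:
  assumes "doubly_periodic p1 p2 w"
  shows "w (q + m * int p1) (r + n * int p2) = w q r"
    and "w (q + m * int p1 - 1) (r + n * int p2) = w (q - 1) r"
    and "w (q + m * int p1) (r + n * int p2 - 1) = w q (r - 1)"
    and "w (q + m * int p1 - 1) (r + n * int p2 - 1) = w (q - 1) (r - 1)"
proof -
  have shift: "w (q + m * int p1) (r + n * int p2) = w q r" for q r
    using assms by (simp add: doubly_periodic_def)
  show "w (q + m * int p1) (r + n * int p2) = w q r"
    "w (q + m * int p1 - 1) (r + n * int p2) = w (q - 1) r"
    "w (q + m * int p1) (r + n * int p2 - 1) = w q (r - 1)"
    "w (q + m * int p1 - 1) (r + n * int p2 - 1) = w (q - 1) (r - 1)"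
    using shift[of q r] shift[of "q - 1" r] shift[of q "r - 1"] shift[of "q - 1" "r - 1"]
    by (simp_all add: diff_add_eq)
qed

lemma jbj_coeff_period_shift:
  assumes "doubly_periodic p1 p2 a" "doubly_periodic p1 p2 \<alpha>"
    "doubly_periodic p1 p2 c" "doubly_periodic p1 p2 b"
  shows "jbj_coeff a \<alpha> c b z s (i + period_shift p1 p2 g) = jbj_coeff a \<alpha> c b z s i"
  by (cases s; cases i; cases g)
     (simp add: jbj_coeff_def jacobi_coeff_def period_shift_def doubly_periodic_shift[OF assms(1)]
       doubly_periodic_shift[OF assms(2)] doubly_periodic_shift[OF assms(3)] doubly_periodic_shift[OF assms(4)])

lemma char_matrix_symbol_mult_bloch:
  assumes p: "2 \<le> p1" "2 \<le> p2"
    and per: "doubly_periodic p1 p2 a" "doubly_periodic p1 p2 \<alpha>"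
      "doubly_periodic p1 p2 c" "doubly_periodic p1 p2 b"
    and w: "bloch p1 p2 x1 x2 (\<lambda>q r. w (q, r))"
  shows "char_matrix (jbj_symbol p1 p2 a \<alpha> c b x1 x2) z *\<^sub>v cell_vec p1 p2 (\<lambda>q r. w (q, r))
       = cell_vec p1 p2 (\<lambda>q r. finite_range_op nbhd (jbj_coeff a \<alpha> c b z) w (q, r))"
proof -
  let ?S = "jbj_symbol p1 p2 a \<alpha> c b x1 x2" and ?v = "cell_vec p1 p2 (\<lambda>q r. w (q, r))"
  have v: "?v \<in> carrier_vec (p1 * p2)" by (simp add: cell_vec_def)
  have "char_matrix ?S z *\<^sub>v ?v = ?S *\<^sub>v ?v + (- z) \<cdot>\<^sub>v ?v"
    unfolding char_matrix_def using v jbj_symbol_carrier[of p1 p2 a \<alpha> c b x1 x2]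
    by (subst add_mult_distrib_mat_vec[of _ "p1 * p2" "p1 * p2"])
       (auto intro!: eq_vecI simp: smult_scalar_prod_distrib[of _ "p1 * p2"])
  also have "\<dots> = cell_vec p1 p2 (\<lambda>q r. finite_range_op nbhd (jbj_coeff a \<alpha> c b z) w (q, r))"
    unfolding jbj_symbol_mult_bloch[OF p per w]
    by (rule eq_vecI)
       (simp_all add: cell_vec_def shifted_jbj_eq_finite_range_op[symmetric] shifted_operator_def)
  finally show ?thesis .
qed

lemma cell_vec_index: "k < p1 * p2 \<Longrightarrow> cell_vec p1 p2 (\<lambda>q r. w (q, r)) $ k = w (cell_index p2 k)"
  by (simp add: cell_vec_def cell_index_def)

lemma jbj_symbol_cong_cis:
  assumes "cis x1 = cis y1" "cis x2 = cis y2"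
  shows "jbj_symbol p1 p2 a \<alpha> c b x1 x2 = jbj_symbol p1 p2 a \<alpha> c b y1 y2"
proof -
  have "cis (- x1) = cis (- y1)" "cis (- x2) = cis (- y2)"
    using assms by (simp_all flip: cis_cnj)
  then show ?thesis unfolding jbj_symbol_def jacobi_symbol_def using assms by (simp only:)
qed

text \<open>The symbol depends on the phases only through \<open>cis\<close>, so every real phase may be replaced by one in the
  half-open torus. So a property of the symbol on the torus holds on the compact closed square as well.\<close>

lemma ex_torus_cis: "\<exists>y1 y2. (y1, y2) \<in> torus \<and> cis x1 = cis y1 \<and> cis x2 = cis y2"
proof -
  have "\<exists>y\<in>{0..<2 * pi}. cis x = cis y" for x
    using Arg2pi[of "cis x"] by (intro bexI[of _ "Arg2pi (cis x)"]) (auto simp: is_Arg_def cis_conv_exp)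
  then show ?thesis unfolding torus_def by blast
qed

lemma l2_finite_support_dense:
  assumes "\<epsilon> > 0"
  obtains v where "finite {i. l2_apply v i \<noteq> 0}" and "norm (u - v) < \<epsilon>"
proof -
  let ?f = "\<lambda>i. (cmod (l2_apply u i))\<^sup>2"
  have "(?f has_sum (norm u)\<^sup>2) UNIV"
    unfolding norm_l2_square using square_summable_l2_apply by (rule has_sum_infsum)
  moreover have "\<epsilon>\<^sup>2 / 2 > 0" using assms by simp
  ultimately obtain F where F: "finite F" "dist (sum ?f F) ((norm u)\<^sup>2) \<le> \<epsilon>\<^sup>2 / 2"
    using has_sum_finite_approximation by blast
  define v where "v = Abs_l2 (\<lambda>i. if i \<in> F then l2_apply u i else 0)"
  have "(\<lambda>i. (cmod (if i \<in> F then l2_apply u i else 0))\<^sup>2) summable_on F"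
    using \<open>finite F\<close> by simp
  then have "(\<lambda>i. (cmod (if i \<in> F then l2_apply u i else 0))\<^sup>2) summable_on UNIV"
    by (rule summable_on_cong_neutral[THEN iffD1, rotated -1]) auto
  then have v: "l2_apply v = (\<lambda>i. if i \<in> F then l2_apply u i else 0)"
    unfolding v_def by (subst Abs_l2_inverse) auto
  have "(norm (u - v))\<^sup>2 = infsum ?f (UNIV - F)"
    unfolding norm_l2_square by (rule infsum_cong_neutral) (auto simp: minus_l2.rep_eq v)
  also have "\<dots> = (norm u)\<^sup>2 - sum ?f F"
    unfolding norm_l2_square using \<open>finite F\<close> square_summable_l2_apply
    by (subst infsum_Diff) auto
  also have "\<dots> < \<epsilon>\<^sup>2"
    using F(2) assms zero_less_power[OF assms, of 2] unfolding dist_real_def by linarith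
  finally have "norm (u - v) < \<epsilon>"
    by (rule power2_less_imp_less) (use assms in linarith)
  moreover have "finite {i. l2_apply v i \<noteq> 0}"
    using \<open>finite F\<close> by (rule rev_finite_subset) (auto simp: v)
  ultimately show thesis using that by blast
qed

lemma bounded_below_of_finite_support:
  fixes T :: "'i l2 \<Rightarrow> 'i l2"
  assumes "linear T" and bnd: "\<And>v. norm (T v) \<le> C * norm v" and "\<delta> > 0"
    and below: "\<And>v. finite {i. l2_apply v i \<noteq> 0} \<Longrightarrow> \<delta> * norm v \<le> norm (T v)"
  shows "\<delta> * norm u \<le> norm (T u)"
proof (rule field_le_epsilon)
  fix e :: real assume "e > 0"
  interpret linear T by fact
  define \<epsilon> where "\<epsilon> = e / (\<bar>C\<bar> + \<delta>)"
  have "\<epsilon> > 0" using \<open>e > 0\<close> \<open>\<delta> > 0\<close> by (simp add: \<epsilon>_def)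
  then obtain v where v: "finite {i. l2_apply v i \<noteq> 0}" "norm (u - v) < \<epsilon>"
    by (rule l2_finite_support_dense)
  have "norm u \<le> norm v + norm (u - v)" using norm_triangle_sub[of u v] by simp
  then have "\<delta> * norm u \<le> \<delta> * norm v + \<delta> * norm (u - v)"
    using \<open>\<delta> > 0\<close> by (metis distrib_left less_imp_le mult_left_mono)
  also have "\<delta> * norm v \<le> norm (T v)" by (rule below[OF v(1)])
  also have "norm (T v) \<le> norm (T u) + norm (T (u - v))"
    using norm_triangle_ineq4[of "T u" "T (u - v)"] by (simp add: diff)
  also have "norm (T (u - v)) \<le> \<bar>C\<bar> * norm (u - v)"
    by (rule order_trans[OF bnd]) (intro mult_right_mono; simp)
  also have "norm (T u) + \<bar>C\<bar> * norm (u - v) + \<delta> * norm (u - v) = norm (T u) + (\<bar>C\<bar> + \<delta>) * norm (u - v)"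
    by (simp add: algebra_simps)
  also have "(\<bar>C\<bar> + \<delta>) * norm (u - v) \<le> (\<bar>C\<bar> + \<delta>) * \<epsilon>"
    using v(2) \<open>\<delta> > 0\<close> by (intro mult_left_mono) auto
  also have "(\<bar>C\<bar> + \<delta>) * \<epsilon> = e" using \<open>\<delta> > 0\<close> by (simp add: \<epsilon>_def)
  finally show "\<delta> * norm u \<le> norm (T u) + e" by simp
qed

lemma finite_range_op_support:
  assumes "\<And>i. u i \<noteq> 0 \<Longrightarrow> \<bar>fst i\<bar> \<le> int M \<and> \<bar>snd i\<bar> \<le> int M"
    and "finite_range_op nbhd c u i \<noteq> 0"
  shows "\<bar>fst i\<bar> \<le> int (Suc M) \<and> \<bar>snd i\<bar> \<le> int (Suc M)"
proof -
  obtain s where s: "s \<in> nbhd" "u (i + s) \<noteq> 0"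
  proof (rule sum.not_neutral_contains_not_neutral[OF assms(2)[unfolded finite_range_op_def]])
    fix s assume "s \<in> nbhd" "c s i * u (i + s) \<noteq> 0"
    then show thesis using mult_not_zero[of "c s i" "u (i + s)"] that by blast
  qed
  have "\<bar>fst s\<bar> \<le> 1" "\<bar>snd s\<bar> \<le> 1" using s(1) by (auto simp: nbhd_def)
  then show ?thesis using assms(1)[OF s(2)] unfolding fst_add snd_add of_nat_Suc by linarith
qed

text \<open>For finitely supported \<open>u\<close> both sides are averages over the grid, by Plancherel. At each grid point
  the Bloch sums of \<open>u\<close> and \<open>(J - z) u\<close> have cell vectors \<open>v\<close> and \<open>(S x - z) v\<close>, and the
  uniform lower bound for the matrices \<open>S x - z\<close> applies.\<close>

lemma shifted_jbj_bounded_below: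
  assumes p: "2 \<le> p1" "2 \<le> p2"
    and per: "doubly_periodic p1 p2 a" "doubly_periodic p1 p2 \<alpha>"
      "doubly_periodic p1 p2 c" "doubly_periodic p1 p2 b"
    and ev: "\<And>x1 x2. (x1, x2) \<in> torus \<Longrightarrow> \<not> eigenvalue (jbj_symbol p1 p2 a \<alpha> c b x1 x2) z"
  obtains \<delta> where "\<delta> > 0" and "\<And>u. \<delta> * norm u \<le> norm (finite_range_l2 nbhd (jbj_coeff a \<alpha> c b z) u)"
proof -
  define S where "S x = jbj_symbol p1 p2 a \<alpha> c b (fst x) (snd x)" for x
  have S: "S x \<in> carrier_mat (p1 * p2) (p1 * p2)" for x
    by (simp add: S_def jbj_symbol_carrier)
  define X where "X = {0..2 * pi} \<times> {0..2 * pi}"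
  have "compact X" unfolding X_def by (intro compact_Times compact_Icc)
  obtain \<delta> where "\<delta> > 0" and below: "\<And>x v. x \<in> X \<Longrightarrow> v \<in> carrier_vec (p1 * p2) \<Longrightarrow>
      \<delta> * (\<Sum>i<p1 * p2. (cmod (v $ i))\<^sup>2) \<le> (\<Sum>i<p1 * p2. (cmod ((char_matrix (S x) z *\<^sub>v v) $ i))\<^sup>2)"
  proof (rule invertible_family_bounded_below[OF \<open>compact X\<close>])
    show "char_matrix (S x) z \<in> carrier_mat (p1 * p2) (p1 * p2)" for x using S by simp
    show "continuous_on X (\<lambda>x. char_matrix (S x) z $$ (i, j))" if "i < p1 * p2" "j < p1 * p2" for i j
    proof -
      have "continuous_on X (\<lambda>x. S x $$ (i, j) + - z * (1\<^sub>m (p1 * p2) $$ (i, j)))"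
        unfolding S_def by (intro continuous_intros continuous_on_jbj_symbol that)
      then show ?thesis
        by (rule continuous_on_eq) (use that carrier_matD[OF S] in \<open>simp add: char_matrix_def\<close>)
    qed
    show "det (char_matrix (S x) z) \<noteq> 0" for x
    proof -
      obtain y1 y2 where y: "(y1, y2) \<in> torus" "cis (fst x) = cis y1" "cis (snd x) = cis y2"
        using ex_torus_cis by blast
      then have "\<not> eigenvalue (S x) z"
        using ev[OF y(1)] jbj_symbol_cong_cis[OF y(2,3)] by (simp add: S_def)
      then show ?thesis by (simp add: eigenvalue_det[OF S])
    qed
  qed blast
  let ?c = "jbj_coeff a \<alpha> c b z"
  obtain K where K: "\<And>s i. cmod (?c s i) \<le> K"
    using jbj_coeff_bounded[OF _ _ per] p by (metis less_le_trans pos2)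
  have fin: "sqrt \<delta> * norm u \<le> norm (finite_range_l2 nbhd ?c u)" if fin: "finite {i. l2_apply u i \<noteq> 0}" for u
  proof -
    let ?u = "l2_apply u" and ?Tu = "finite_range_op nbhd ?c (l2_apply u)"
    obtain M :: nat where M: "\<And>i. ?u i \<noteq> 0 \<Longrightarrow> \<bar>fst i\<bar> \<le> int M \<and> \<bar>snd i\<bar> \<le> int M"
    proof -
      have "finite ((\<lambda>i. nat (max \<bar>fst i\<bar> \<bar>snd i\<bar>)) ` {i. ?u i \<noteq> 0})" using fin by simp
      then obtain M where "\<forall>n\<in>(\<lambda>i. nat (max \<bar>fst i\<bar> \<bar>snd i\<bar>)) ` {i. ?u i \<noteq> 0}. n \<le> M"
        using finite_nat_set_iff_bounded_le by blast
      then show thesis using that[of M] by (force simp: nat_le_iff)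
    qed
    have M1: "?u i \<noteq> 0 \<Longrightarrow> \<bar>fst i\<bar> \<le> int (Suc M) \<and> \<bar>snd i\<bar> \<le> int (Suc M)" for i
      using M[of i] by auto
    have M2: "?Tu i \<noteq> 0 \<Longrightarrow> \<bar>fst i\<bar> \<le> int (Suc M) \<and> \<bar>snd i\<bar> \<le> int (Suc M)" for i
      by (rule finite_range_op_support[OF M])
    \<comment> \<open>The operator enlarges the support by one site, so \<open>Suc M\<close> works for \<open>u\<close> and for its image.\<close>
    define N where "N = 2 * (Suc M + 1) + 1"
    have N: "2 * (Suc M + 1) < N" "0 < N" by (simp_all add: N_def)
    have p0: "0 < p1" "0 < p2" using p by auto
    have cell: "\<delta> * (\<Sum>k<p1 * p2. (cmod (bloch_sum p1 p2 x1 x2 ?u (cell_index p2 k)))\<^sup>2)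
        \<le> (\<Sum>k<p1 * p2. (cmod (bloch_sum p1 p2 x1 x2 ?Tu (cell_index p2 k)))\<^sup>2)" if "(x1, x2) \<in> X" for x1 x2
    proof -
      let ?w = "bloch_sum p1 p2 x1 x2 ?u"
      have "bloch_sum p1 p2 x1 x2 ?Tu i = finite_range_op nbhd ?c ?w i" for i
        by (rule bloch_sum_finite_range_op[OF p0 fin jbj_coeff_period_shift[OF per]])
      then have "(char_matrix (S (x1, x2)) z *\<^sub>v cell_vec p1 p2 (\<lambda>q r. ?w (q, r))) $ k
          = bloch_sum p1 p2 x1 x2 ?Tu (cell_index p2 k)" if "k < p1 * p2" for k
        using that by (simp add: S_def char_matrix_symbol_mult_bloch[OF p per bloch_bloch_sum] cell_vec_index)
      then show ?thesis
        using below[OF that, of "cell_vec p1 p2 (\<lambda>q r. ?w (q, r))"]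
        by (simp add: cell_vec_index carrier_vecI)
    qed
    have grid: "(grid N j, grid N l) \<in> X" if "j < N" "l < N" for j l
      using that \<open>0 < N\<close> by (auto simp: grid_def X_def field_simps)
    let ?E = "\<lambda>f j l. \<Sum>k<p1 * p2. (cmod (bloch_sum p1 p2 (grid N j) (grid N l) f (cell_index p2 k)))\<^sup>2"
    have planch: "(real N)\<^sup>2 * (norm u)\<^sup>2 = (\<Sum>j<N. \<Sum>l<N. ?E ?u j l)"
      "(real N)\<^sup>2 * (norm (finite_range_l2 nbhd ?c u))\<^sup>2 = (\<Sum>j<N. \<Sum>l<N. ?E ?Tu j l)"
      unfolding norm_l2_square l2_apply_finite_range_l2[OF K]
      using bloch_plancherel[OF p0 M1 N(1)] bloch_plancherel[OF p0 M2 N(1)] by simp_all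
    have "\<delta> * ((real N)\<^sup>2 * (norm u)\<^sup>2) \<le> (real N)\<^sup>2 * (norm (finite_range_l2 nbhd ?c u))\<^sup>2"
      unfolding planch sum_distrib_left[of \<delta> _ "{..<N}"] by (intro sum_mono cell grid) auto
    then have "\<delta> * (norm u)\<^sup>2 \<le> (norm (finite_range_l2 nbhd ?c u))\<^sup>2"
      using \<open>0 < N\<close> by (simp add: mult.left_commute)
    then have "(sqrt \<delta> * norm u)\<^sup>2 \<le> (norm (finite_range_l2 nbhd ?c u))\<^sup>2"
      using \<open>\<delta> > 0\<close> by (simp add: power_mult_distrib)
    then show ?thesis by (rule power2_le_imp_le) simp
  qed
  have "sqrt \<delta> * norm u \<le> norm (finite_range_l2 nbhd ?c u)" for u
    by (rule bounded_below_of_finite_support[OF linear_finite_range_l2[OF K] norm_finite_range_l2_le[OF K] _ fin])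
       (simp add: \<open>\<delta> > 0\<close>)
  then show thesis using that[of "sqrt \<delta>"] \<open>\<delta> > 0\<close> by simp
qed

section \<open>Eigenvalues of the symbol are in the spectrum\<close>

lemma shifted_jbj_finite_range_l2:
  assumes K: "\<And>s i. cmod (jbj_coeff a \<alpha> c b z s i) \<le> K"
  shows "shifted_operator (jacobi_block_jacobi a \<alpha> c b) z (of_l2 v)
       = of_l2 (finite_range_l2 nbhd (jbj_coeff a \<alpha> c b z) v)"
  by (intro ext)
     (simp add: of_l2_def[abs_def] shifted_jbj_eq_finite_range_op l2_apply_finite_range_l2[OF K])

lemma jbj_coeff_shift:
  "finite_range_op nbhd (jbj_coeff a \<alpha> c b z) u i
     = finite_range_op nbhd (jbj_coeff a \<alpha> c b y) u i + (y - z) * u i"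
  by (cases i) (simp add: shifted_jbj_eq_finite_range_op[symmetric] shifted_operator_def algebra_simps)

text \<open>Write \<open>J - z\<close> as \<open>T - \<i> Im z\<close> with \<open>T = J - Re z\<close>. As \<open>T\<close> is symmetric and commutes with multiplication by
  \<open>\<i>\<close>, the vector \<open>T u\<close> is orthogonal to \<open>\<i> u\<close>. Pairing \<open>(J - z) u\<close> with \<open>\<i> u\<close> leaves \<open>- Im z \<parallel>u\<parallel>\<^sup>2\<close>.\<close>

lemma shifted_jbj_imag_bound:
  assumes K: "\<And>z. \<exists>K. \<forall>s i. cmod (jbj_coeff a \<alpha> c b z s i) \<le> K"
  shows "\<bar>Im z\<bar> * norm u \<le> norm (finite_range_l2 nbhd (jbj_coeff a \<alpha> c b z) u)"
proof (cases "u = 0")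
  case False
  let ?T = "\<lambda>z. finite_range_l2 nbhd (jbj_coeff a \<alpha> c b z)"
  let ?r = "complex_of_real (Re z)" and ?iu = "cscale \<i> u"
  have apply_T: "l2_apply (?T z v) = finite_range_op nbhd (jbj_coeff a \<alpha> c b z) (l2_apply v)" for z v
    using K[of z] l2_apply_finite_range_l2 by blast
  have sym: "?T ?r v \<bullet> w = v \<bullet> ?T ?r w" for v w
  proof -
    obtain K' where "\<And>s i. cmod (jbj_coeff a \<alpha> c b ?r s i) \<le> K'" using K by blast
    then show ?thesis
      using jbj_coeff_adjoint[of _ a \<alpha> c b ?r] by (intro inner_finite_range_l2 uminus_nbhd) simp_all
  qed
  have i_adj: "cscale \<i> v \<bullet> w = - (v \<bullet> cscale \<i> w)" for v w :: "(int \<times> int) l2"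
  proof -
    have "cscale \<i> v \<bullet> w = v \<bullet> cscale (- \<i>) w"
      unfolding cscale_def by (subst inner_weighted_shift[where K = 1]) simp_all
    also have "cscale (- \<i>) w = - cscale \<i> w"
      by (rule l2_eqI) (simp add: l2_apply_cscale uminus_l2.rep_eq)
    finally show ?thesis by simp
  qed
  have "?T ?r ?iu = cscale \<i> (?T ?r u)"
    by (rule l2_eqI) (simp add: apply_T l2_apply_cscale finite_range_op_def sum_distrib_left mult_ac)
  then have "?T ?r u \<bullet> ?iu = - (?T ?r u \<bullet> ?iu)"
    using sym[of u ?iu] i_adj[of u "?T ?r u"] by (simp add: inner_commute)
  then have zero: "?T ?r u \<bullet> ?iu = 0" by simp
  have "?T z u = ?T ?r u - Im z *\<^sub>R ?iu"
  proof (rule l2_eqI)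
    fix i
    have "l2_apply (?T z u) i = l2_apply (?T ?r u) i + (?r - z) * l2_apply u i"
      unfolding apply_T by (rule jbj_coeff_shift)
    moreover have "?r - z = - (\<i> * complex_of_real (Im z))"
      by (simp add: complex_eq_iff)
    ultimately show "l2_apply (?T z u) i = l2_apply (?T ?r u - Im z *\<^sub>R ?iu) i"
      by (simp add: minus_l2.rep_eq scaleR_l2.rep_eq l2_apply_cscale scaleR_conv_of_real)
  qed
  then have "?T z u \<bullet> ?iu = - Im z * (norm ?iu)\<^sup>2"
    using zero by (simp add: inner_diff_left power2_norm_eq_inner)
  moreover have "(norm ?iu)\<^sup>2 = (norm u)\<^sup>2"
    unfolding norm_l2_square by (simp add: l2_apply_cscale norm_mult)
  then have "norm ?iu = norm u" by simp
  ultimately have "\<bar>Im z\<bar> * (norm u)\<^sup>2 \<le> norm (?T z u) * norm u"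
    using Cauchy_Schwarz_ineq2[of "?T z u" ?iu] by (simp add: abs_mult)
  then show ?thesis using False by (simp add: power2_eq_square)
qed simp

text \<open>The frame around a box, on which a cut-off Bloch function fails to solve the eigenvalue equation, has a
  size proportional to the side lengths and not to the area.\<close>

lemma card_frame_le:
  fixes M1 M2 :: int
  assumes "2 \<le> M1" "2 \<le> M2"
  shows "card ({0..M1 + 1} \<times> {0..M2 + 1} - {2..M1 - 1} \<times> {2..M2 - 1}) \<le> nat (4 * (M1 + M2))"
proof -
  have "card ({0..M1 + 1} \<times> {0..M2 + 1} - {2..M1 - 1} \<times> {2..M2 - 1})
      = nat (2 + M1) * nat (2 + M2) - nat (M1 - 2) * nat (M2 - 2)"
    by (subst card_Diff_subset) (auto simp: card_cartesian_product)
  also have "\<dots> = nat ((2 + M1) * (2 + M2)) - nat ((M1 - 2) * (M2 - 2))"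
    using assms by (simp add: nat_mult_distrib)
  also have "\<dots> = nat (4 * (M1 + M2))"
    using assms mult_nonneg_nonneg[of "M1 - 2" "M2 - 2"]
    by (subst nat_diff_distrib[symmetric]) (auto simp: algebra_simps)
  finally show ?thesis by simp
qed

text \<open>The Bloch function \<open>w\<close> that extends an eigenvector \<open>v\<close> solves \<open>(J - z) w = 0\<close>. If \<open>J - z\<close> were
  bounded below by \<open>\<delta>\<close>, then comparing the two norms for the cut-off of \<open>w\<close> to \<open>N \<times> N\<close> cells would give
  \<open>\<delta>\<^sup>2 N\<^sup>2 \<le> const \<cdot> N\<close> for all \<open>N\<close>.\<close>

lemma eigenvalue_symbol_not_bounded_below:
  assumes p: "2 \<le> p1" "2 \<le> p2"
    and per: "doubly_periodic p1 p2 a" "doubly_periodic p1 p2 \<alpha>"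
      "doubly_periodic p1 p2 c" "doubly_periodic p1 p2 b"
    and ev: "eigenvalue (jbj_symbol p1 p2 a \<alpha> c b x1 x2) z"
    and "\<delta> > 0"
  shows "\<exists>u. norm (finite_range_l2 nbhd (jbj_coeff a \<alpha> c b z) u) < \<delta> * norm u"
proof (rule ccontr)
  let ?c = "jbj_coeff a \<alpha> c b z"
  assume "\<not> ?thesis"
  then have below: "\<delta> * norm u \<le> norm (finite_range_l2 nbhd ?c u)" for u
    by (simp add: not_less)
  have p0: "0 < p1" "0 < p2" using p by auto
  obtain K where K: "\<And>s i. cmod (?c s i) \<le> K"
    using jbj_coeff_bounded[OF p0 per] by blast
  obtain v where v: "v \<in> carrier_vec (p1 * p2)" "v \<noteq> 0\<^sub>v (p1 * p2)"
    "char_matrix (jbj_symbol p1 p2 a \<alpha> c b x1 x2) z *\<^sub>v v = 0\<^sub>v (p1 * p2)"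
    using ev eigenvalue_char_matrix[OF jbj_symbol_carrier] by blast
  obtain k0 where k0: "k0 < p1 * p2" "v $ k0 \<noteq> 0"
    using v(1,2) by (metis carrier_vecD eq_vecI index_zero_vec)
  define cell where "cell = cell_index p2 ` {..<p1 * p2}"
  have inj_cell: "inj_on (\<lambda>(k, g). cell_index p2 k + period_shift p1 p2 g) ({..<p1 * p2} \<times> UNIV)"
    using bij_betw_cells[OF p0] by (rule bij_betw_imp_inj_on)
  have period_shift_zero: "period_shift p1 p2 (0, 0) = 0" by (simp add: period_shift_def zero_prod_def)
  \<comment> \<open>\<open>f\<close> places the eigenvector on the period cell; its Bloch sum is the Bloch function extending it.\<close>
  define f where "f i = (\<Sum>k<p1 * p2. if i = cell_index p2 k then v $ k else 0)" for i
  have f: "f (cell_index p2 k + period_shift p1 p2 g) = (if g = (0, 0) then v $ k else 0)" if "k < p1 * p2" for k g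
  proof -
    have "cell_index p2 k + period_shift p1 p2 g = cell_index p2 l \<longleftrightarrow> l = k \<and> g = (0, 0)" if "l < p1 * p2" for l
      using inj_onD[OF inj_cell, of "(k, g)" "(l, (0, 0))"] that \<open>k < p1 * p2\<close>
      by (auto simp: period_shift_zero)
    then have "f (cell_index p2 k + period_shift p1 p2 g)
        = (\<Sum>l<p1 * p2. if l = k then if g = (0, 0) then v $ k else 0 else 0)"
      unfolding f_def by (intro sum.cong refl) auto
    then show ?thesis using that by simp
  qed
  have fin: "finite {i. f i \<noteq> 0}"
  proof (rule finite_subset)
    show "{i. f i \<noteq> 0} \<subseteq> cell"
    proof (intro subsetI CollectI, rule ccontr)
      fix i assume "i \<in> {i. f i \<noteq> 0}" "i \<notin> cell"
      then have "f i = 0" unfolding f_def cell_def by (intro sum.neutral) auto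
      then show False using \<open>i \<in> {i. f i \<noteq> 0}\<close> by simp
    qed
  qed (simp add: cell_def)
  define w where "w = bloch_sum p1 p2 x1 x2 f"
  have w: "bloch p1 p2 x1 x2 (\<lambda>q r. w (q, r))"
    unfolding w_def by (rule bloch_bloch_sum)
  have w_cell: "w (cell_index p2 k) = v $ k" if "k < p1 * p2" for k
  proof -
    have "w (cell_index p2 k) = (\<Sum>\<^sub>\<infinity>g::int \<times> int. if g = (0, 0) then v $ k else 0)"
    proof -
      have eq: "(case g of (m, n) \<Rightarrow> cis (of_int m * x1 + of_int n * x2) * f (cell_index p2 k + period_shift p1 p2 (m, n)))
          = (if g = (0, 0) then v $ k else 0)" for g :: "int \<times> int"
        by (cases g) (simp add: f[OF that])
      show ?thesis unfolding w_def bloch_sum_def by (rule infsum_cong) (rule eq)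
    qed
    also have "\<dots> = (\<Sum>\<^sub>\<infinity>g\<in>{(0, 0) :: int \<times> int}. if g = (0, 0) then v $ k else 0)"
      by (rule infsum_cong_neutral) auto
    finally show ?thesis by simp
  qed
  have norm_period_shift: "cmod (y (i + period_shift p1 p2 g)) = cmod (y i)"
    if y: "bloch p1 p2 x1 x2 (\<lambda>q r. y (q, r))" for y i g
  proof -
    obtain q r m n where ig: "i = (q, r)" "g = (m, n)" by (cases i; cases g)
    have step: "cmod (y (q + int p1, r)) = cmod (y (q, r))" "cmod (y (q, r + int p2)) = cmod (y (q, r))" for q r
      using y by (simp_all add: bloch_def norm_mult)
    have "cmod (y (q + m * int p1, r)) = cmod (y (q, r))" for q r
    proof (induction m rule: int_induct[where k = 0])
      case (step1 m)
      then show ?case using step(1)[of "q + m * int p1" r] by (simp add: algebra_simps)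
    next
      case (step2 m)
      then show ?case using step(1)[of "q + (m - 1) * int p1" r] by (simp add: algebra_simps)
    qed simp
    moreover have "cmod (y (q, r + n * int p2)) = cmod (y (q, r))" for q r
    proof (induction n rule: int_induct[where k = 0])
      case (step1 n)
      then show ?case using step(2)[of q "r + n * int p2"] by (simp add: algebra_simps)
    next
      case (step2 n)
      then show ?case using step(2)[of q "r + (n - 1) * int p2"] by (simp add: algebra_simps)
    qed simp
    ultimately show ?thesis by (simp add: ig period_shift_def)
  qed
  have decompose: "\<exists>k<p1 * p2. \<exists>g. i = cell_index p2 k + period_shift p1 p2 g" for i
  proof -
    have "i \<in> (\<lambda>(k, g). cell_index p2 k + period_shift p1 p2 g) ` ({..<p1 * p2} \<times> UNIV)"
      unfolding bij_betw_imp_surj_on[OF bij_betw_cells[OF p0]] by simp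
    then obtain k g where "k < p1 * p2" "i = cell_index p2 k + period_shift p1 p2 g"
      by (elim imageE SigmaE) simp
    then show ?thesis by blast
  qed
  define B where "B = (\<Sum>k<p1 * p2. cmod (v $ k))"
  have w_le: "cmod (w i) \<le> B" for i
  proof -
    obtain k g where k: "k < p1 * p2" "i = cell_index p2 k + period_shift p1 p2 g" using decompose by blast
    then have "cmod (w i) = cmod (v $ k)" using norm_period_shift[OF w] w_cell by simp
    also have "\<dots> \<le> B" unfolding B_def using k(1) by (intro member_le_sum) auto
    finally show ?thesis .
  qed
  have Tw: "finite_range_op nbhd ?c w i = 0" for i
  proof -
    let ?Tw = "finite_range_op nbhd ?c w"
    have Tw_eq: "?Tw = bloch_sum p1 p2 x1 x2 (finite_range_op nbhd ?c f)"
      unfolding w_def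
      by (intro ext bloch_sum_finite_range_op[symmetric] p0 fin) (rule jbj_coeff_period_shift[OF per])
    have bl: "bloch p1 p2 x1 x2 (\<lambda>q r. ?Tw (q, r))"
      unfolding Tw_eq by (rule bloch_bloch_sum)
    have cell: "cell_vec p1 p2 (\<lambda>q r. w (q, r)) = v"
      using v(1) by (intro eq_vecI) (simp_all add: cell_vec_index w_cell)
    obtain k g where k: "k < p1 * p2" "i = cell_index p2 k + period_shift p1 p2 g" using decompose by blast
    have "?Tw (cell_index p2 k) = cell_vec p1 p2 (\<lambda>q r. ?Tw (q, r)) $ k"
      using k(1) by (rule cell_vec_index[symmetric])
    also have "\<dots> = 0"
      unfolding char_matrix_symbol_mult_bloch[OF p per w, symmetric] cell v(3) using k(1) by simp
    finally show ?thesis using norm_period_shift[OF bl, of "cell_index p2 k" g] k(2) by simp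
  qed
  \<comment> \<open>An upper bound for \<open>(J - z)\<close> applied to any cut-off of \<open>w\<close>: nine terms, each at most \<open>K * B\<close>.\<close>
  define C where "C = 9 * K * B"
  have "0 \<le> B" unfolding B_def by (intro sum_nonneg) auto
  have bound: "\<delta>\<^sup>2 * (cmod (v $ k0))\<^sup>2 * real N \<le> C\<^sup>2 * (4 * (real p1 + real p2))" if "N \<ge> 1" for N :: nat
  proof -
    define M1 where "M1 = int N * int p1"
    define M2 where "M2 = int N * int p2"
    have M: "2 \<le> M1" "2 \<le> M2"
      using mult_mono[of 1 "int N" 2 "int p1"] mult_mono[of 1 "int N" 2 "int p2"] that p
      by (simp_all add: M1_def M2_def)
    define Q where "Q = {1..M1} \<times> {1..M2}"
    \<comment> \<open>The sites with neighbours both inside and outside of \<open>Q\<close> are contained in \<open>A\<close>.\<close>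
    define A where "A = {0..M1 + 1} \<times> {0..M2 + 1} - {2..M1 - 1} \<times> {2..M2 - 1}"
    have "finite Q" "finite A" by (auto simp: Q_def A_def)
    define g where "g i = (if i \<in> Q then w i else 0)" for i
    have "(\<lambda>i. (cmod (g i))\<^sup>2) summable_on Q" using \<open>finite Q\<close> by simp
    then have "(\<lambda>i. (cmod (g i))\<^sup>2) summable_on UNIV"
      by (rule summable_on_cong_neutral[THEN iffD1, rotated -1]) (simp_all add: g_def)
    then have u: "l2_apply (Abs_l2 g) = g" by (subst Abs_l2_inverse) simp_all
    let ?u = "Abs_l2 g"
    let ?Tu = "finite_range_op nbhd ?c g"
    have outside: "?Tu i = 0" if "i \<notin> A" for i
    proof (cases "i \<in> {2..M1 - 1} \<times> {2..M2 - 1}")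
      case True
      have "g (i + s) = w (i + s)" if "s \<in> nbhd" for s
        using True that by (auto simp: g_def Q_def nbhd_def)
      then have "?Tu i = finite_range_op nbhd ?c w i"
        by (simp add: finite_range_op_def)
      then show ?thesis using Tw by simp
    next
      case False
      then have i: "i \<notin> {0..M1 + 1} \<times> {0..M2 + 1}" using \<open>i \<notin> A\<close> by (simp add: A_def)
      have "g (i + s) = 0" if "s \<in> nbhd" for s
        using i that by (cases i) (auto simp: g_def Q_def nbhd_def)
      then show ?thesis by (simp add: finite_range_op_def)
    qed
    have le_C: "cmod (?Tu i) \<le> C" for i
    proof -
      have "cmod (?Tu i) \<le> real (card nbhd) * (K * B)"
        unfolding finite_range_op_def
      proof (rule sum_norm_bound)
        fix s
        have "0 \<le> K" using K[of 0 0] norm_ge_zero order_trans by blast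
        moreover have "cmod (g (i + s)) \<le> B" using w_le \<open>0 \<le> B\<close> by (simp add: g_def)
        ultimately show "cmod (?c s i * g (i + s)) \<le> K * B"
          unfolding norm_mult by (intro mult_mono K) auto
      qed
      moreover have "card nbhd = 9" by (simp add: nbhd_def card_cartesian_product)
      ultimately show ?thesis by (simp add: C_def)
    qed
    have "(norm (finite_range_l2 nbhd ?c ?u))\<^sup>2 = (\<Sum>i\<in>A. (cmod (?Tu i))\<^sup>2)"
    proof -
      have "(\<Sum>\<^sub>\<infinity>i. (cmod (?Tu i))\<^sup>2) = (\<Sum>\<^sub>\<infinity>i\<in>A. (cmod (?Tu i))\<^sup>2)"
        by (rule infsum_cong_neutral) (simp_all add: outside)
      then show ?thesis using \<open>finite A\<close> by (simp add: norm_l2_square l2_apply_finite_range_l2[OF K] u)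
    qed
    also have "\<dots> \<le> (\<Sum>i\<in>A. C\<^sup>2)"
      by (intro sum_mono power_mono le_C) simp
    also have "\<dots> = C\<^sup>2 * real (card A)" by simp
    also have "\<dots> \<le> C\<^sup>2 * (4 * (real p1 + real p2) * real N)"
    proof (rule mult_left_mono)
      have "real (card A) \<le> real (nat (4 * (M1 + M2)))"
        using card_frame_le[OF M] unfolding A_def by simp
      also have "\<dots> = 4 * (real p1 + real p2) * real N"
        using M by (simp add: M1_def M2_def algebra_simps)
      finally show "real (card A) \<le> 4 * (real p1 + real p2) * real N" .
    qed simp
    finally have upper: "(norm (finite_range_l2 nbhd ?c ?u))\<^sup>2 \<le> C\<^sup>2 * (4 * (real p1 + real p2) * real N)" .
    \<comment> \<open>The site \<open>k0\<close> where \<open>v\<close> does not vanish has one translate in each of the \<open>N\<^sup>2\<close> cells of \<open>Q\<close>.\<close>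
    let ?L = "{0..<int N} \<times> {0..<int N}"
    define h where "h y = cell_index p2 k0 + period_shift p1 p2 y" for y
    have "inj_on h ?L"
      using inj_period_shift[OF p0] by (auto simp: h_def inj_on_def)
    have h_Q: "h ` ?L \<subseteq> Q"
    proof (intro image_subsetI)
      fix y assume y: "y \<in> ?L"
      have window: "1 \<le> q + 1 + m * int l \<and> q + 1 + m * int l \<le> int N * int l"
        if "0 \<le> q" "q < int l" "0 \<le> m" "m < int N" for q m :: int and l
      proof -
        have "(m + 1) * int l \<le> int N * int l" using that by (intro mult_right_mono) auto
        then show ?thesis using that by (simp add: distrib_right)
      qed
      have "k0 div p2 < p1" "k0 mod p2 < p2"
        using k0(1) p0 by (auto simp: less_mult_imp_div_less)
      then show "h y \<in> Q"
        using y window[of "int (k0 div p2)" p1 "fst y"] window[of "int (k0 mod p2)" p2 "snd y"]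
        by (cases y) (simp add: h_def Q_def M1_def M2_def cell_index_def period_shift_def del: of_nat_div of_nat_mod)
    qed
    have "(real N)\<^sup>2 * (cmod (v $ k0))\<^sup>2 = (\<Sum>y\<in>?L. (cmod (g (h y)))\<^sup>2)"
    proof -
      have "cmod (g (h y)) = cmod (v $ k0)" if "y \<in> ?L" for y
        using subsetD[OF h_Q imageI[OF that]] norm_period_shift[OF w, of "cell_index p2 k0" y] w_cell[OF k0(1)]
        unfolding h_def g_def by simp
      then have "(\<Sum>y\<in>?L. (cmod (g (h y)))\<^sup>2) = (\<Sum>y\<in>?L. (cmod (v $ k0))\<^sup>2)"
        by (intro sum.cong) auto
      then show ?thesis by (simp add: card_cartesian_product power2_eq_square)
    qed
    also have "\<dots> = (\<Sum>i\<in>h ` ?L. (cmod (g i))\<^sup>2)"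
      by (simp add: sum.reindex[OF \<open>inj_on h ?L\<close>])
    also have "\<dots> \<le> (norm ?u)\<^sup>2"
      using sum_le_norm_l2_square[of "h ` ?L" ?u] by (simp add: u)
    finally have lower: "(real N)\<^sup>2 * (cmod (v $ k0))\<^sup>2 \<le> (norm ?u)\<^sup>2" .
    have "\<delta>\<^sup>2 * ((real N)\<^sup>2 * (cmod (v $ k0))\<^sup>2) \<le> \<delta>\<^sup>2 * (norm ?u)\<^sup>2"
      by (intro mult_left_mono lower) simp
    also have "\<dots> = (\<delta> * norm ?u)\<^sup>2" by (simp add: power_mult_distrib)
    also have "\<dots> \<le> (norm (finite_range_l2 nbhd ?c ?u))\<^sup>2"
      using \<open>\<delta> > 0\<close> by (intro power_mono below) simp
    also note upper
    finally have "real N * (\<delta>\<^sup>2 * (cmod (v $ k0))\<^sup>2 * real N) \<le> real N * (C\<^sup>2 * (4 * (real p1 + real p2)))"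
      by (simp add: power2_eq_square mult_ac)
    then show ?thesis using \<open>N \<ge> 1\<close> by simp
  qed
  have "\<delta>\<^sup>2 * (cmod (v $ k0))\<^sup>2 > 0" using \<open>\<delta> > 0\<close> k0(2) by simp
  then obtain N :: nat where N: "C\<^sup>2 * (4 * (real p1 + real p2)) < real N * (\<delta>\<^sup>2 * (cmod (v $ k0))\<^sup>2)"
    using reals_Archimedean3[THEN spec] by blast
  also have "\<dots> \<le> real (max N 1) * (\<delta>\<^sup>2 * (cmod (v $ k0))\<^sup>2)"
    by (intro mult_right_mono) auto
  finally show False
    using bound[of "max N 1", OF max.cobounded2] unfolding mult.commute[of _ "real (max N 1)"] by linarith
qed

text \<open>An eigenvalue of the symbol makes \<open>J - z\<close> fail to be bounded below, whereas a symmetric operator is bounded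
  below after a shift off the real axis.\<close>

lemma eigenvalue_jbj_symbol_real:
  assumes p: "2 \<le> p1" "2 \<le> p2"
    and per: "doubly_periodic p1 p2 a" "doubly_periodic p1 p2 \<alpha>"
      "doubly_periodic p1 p2 c" "doubly_periodic p1 p2 b"
    and ev: "eigenvalue (jbj_symbol p1 p2 a \<alpha> c b x1 x2) z"
  shows "Im z = 0"
proof (rule ccontr)
  have p0: "0 < p1" "0 < p2" using p by auto
  have K: "\<exists>K. \<forall>s i. cmod (jbj_coeff a \<alpha> c b z s i) \<le> K" for z
    by (rule jbj_coeff_bounded[OF p0 per, of z]) blast
  assume "Im z \<noteq> 0"
  then obtain u where "norm (finite_range_l2 nbhd (jbj_coeff a \<alpha> c b z) u) < \<bar>Im z\<bar> * norm u"
    using eigenvalue_symbol_not_bounded_below[OF p per ev, of "\<bar>Im z\<bar>"] by auto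
  then show False using shifted_jbj_imag_bound[OF K, of z u] by linarith
qed

lemma operator_spectrum_jbj:
  assumes p: "2 \<le> p1" "2 \<le> p2"
    and per: "doubly_periodic p1 p2 a" "doubly_periodic p1 p2 \<alpha>"
      "doubly_periodic p1 p2 c" "doubly_periodic p1 p2 b"
  shows "operator_spectrum (jacobi_block_jacobi a \<alpha> c b)
       = {z. \<exists>(x1, x2)\<in>torus. eigenvalue (jbj_symbol p1 p2 a \<alpha> c b x1 x2) z}"
proof -
  let ?T = "\<lambda>z. finite_range_l2 nbhd (jbj_coeff a \<alpha> c b z)"
  have p0: "0 < p1" "0 < p2" using p by auto
  have K: "\<exists>K. \<forall>s i. cmod (jbj_coeff a \<alpha> c b z s i) \<le> K" for z
    by (rule jbj_coeff_bounded[OF p0 per, of z]) blast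
  have shift: "shifted_operator (jacobi_block_jacobi a \<alpha> c b) z (of_l2 v) = of_l2 (?T z v)" for z v
  proof -
    obtain K' where "\<And>s i. cmod (jbj_coeff a \<alpha> c b z s i) \<le> K'" using K[of z] by blast
    then show ?thesis by (rule shifted_jbj_finite_range_l2)
  qed
  show "operator_spectrum (jacobi_block_jacobi a \<alpha> c b)
       = {z. \<exists>(x1, x2)\<in>torus. eigenvalue (jbj_symbol p1 p2 a \<alpha> c b x1 x2) z}"
  proof (intro subset_antisym subsetI)
    fix z assume "z \<in> {z. \<exists>(x1, x2)\<in>torus. eigenvalue (jbj_symbol p1 p2 a \<alpha> c b x1 x2) z}"
    then obtain x1 x2 where ev: "eigenvalue (jbj_symbol p1 p2 a \<alpha> c b x1 x2) z" by auto
    show "z \<in> operator_spectrum (jacobi_block_jacobi a \<alpha> c b)"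
    proof (rule ccontr)
      assume "z \<notin> operator_spectrum (jacobi_block_jacobi a \<alpha> c b)"
      then obtain C where "C > 0" and C: "\<And>v. norm v \<le> C * norm (?T z v)"
        by (rule bounded_below_if_not_in_spectrum[OF shift]) (rule that)
      obtain u where "norm (?T z u) < 1 / C * norm u"
        using eigenvalue_symbol_not_bounded_below[OF p per ev, of "1 / C"] \<open>C > 0\<close> by auto
      then show False using C[of u] \<open>C > 0\<close> by (simp add: field_simps)
    qed
  next
    fix z assume z: "z \<in> operator_spectrum (jacobi_block_jacobi a \<alpha> c b)"
    show "z \<in> {z. \<exists>(x1, x2)\<in>torus. eigenvalue (jbj_symbol p1 p2 a \<alpha> c b x1 x2) z}"
    proof (rule ccontr)
      assume notin: "z \<notin> {z. \<exists>(x1, x2)\<in>torus. eigenvalue (jbj_symbol p1 p2 a \<alpha> c b x1 x2) z}"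
      have no: "\<not> eigenvalue (jbj_symbol p1 p2 a \<alpha> c b x1 x2) z" if "(x1, x2) \<in> torus" for x1 x2
      proof
        assume "eigenvalue (jbj_symbol p1 p2 a \<alpha> c b x1 x2) z"
        then have "z \<in> {z. \<exists>(x1, x2)\<in>torus. eigenvalue (jbj_symbol p1 p2 a \<alpha> c b x1 x2) z}"
          by (intro CollectI bexI[OF _ that]) simp
        then show False using notin by contradiction
      qed
      have no': "\<not> eigenvalue (jbj_symbol p1 p2 a \<alpha> c b x1 x2) (cnj z)" if "(x1, x2) \<in> torus" for x1 x2
      proof
        assume ev: "eigenvalue (jbj_symbol p1 p2 a \<alpha> c b x1 x2) (cnj z)"
        then have "cnj z = z" using eigenvalue_jbj_symbol_real[OF p per ev] by (simp add: complex_eq_iff)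
        then show False using ev no[OF that] by simp
      qed
      obtain \<delta> where \<delta>: "\<delta> > 0" "\<And>u. \<delta> * norm u \<le> norm (?T z u)"
        by (rule shifted_jbj_bounded_below[OF p per no], assumption) (rule that)
      obtain \<delta>' where \<delta>': "\<delta>' > 0" "\<And>u. \<delta>' * norm u \<le> norm (?T (cnj z) u)"
        by (rule shifted_jbj_bounded_below[OF p per no'], assumption) (rule that)
      obtain K1 where K1: "\<And>s i. cmod (jbj_coeff a \<alpha> c b z s i) \<le> K1" using K by blast
      obtain K2 where K2: "\<And>s i. cmod (jbj_coeff a \<alpha> c b (cnj z) s i) \<le> K2" using K by blast
      define C where "C = real (card nbhd) * max K1 K2"
      have bnd: "norm (?T z v) \<le> C * norm v" "norm (?T (cnj z) v) \<le> C * norm v" for v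
        unfolding C_def
        by (intro norm_finite_range_l2_le, rule order_trans[OF K1], simp,
            intro norm_finite_range_l2_le, rule order_trans[OF K2], simp)
      have "surj (?T z)"
        by (rule surj_if_adjoint_bounded_below[OF linear_finite_range_l2[OF K1] linear_finite_range_l2[OF K2] bnd _ \<delta>'])
           (rule inner_finite_range_l2[OF K1 uminus_nbhd], rule jbj_coeff_adjoint)
      moreover have "?T z (cscale x v) = cscale x (?T z v)" for x v
        by (rule l2_eqI)
           (simp add: l2_apply_finite_range_l2[OF K1] l2_apply_cscale finite_range_op_def sum_distrib_left mult_ac)
      ultimately have "z \<notin> operator_spectrum (jacobi_block_jacobi a \<alpha> c b)"
        using not_in_spectrum_if_bijective[OF shift linear_add[OF linear_finite_range_l2[OF K1]] _ _ \<delta>] by blast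
      then show False using z by contradiction
    qed
  qed
qed

section \<open>Continuity of the ordered eigenvalues\<close>

lemma sum_singleton_mset: "finite A \<Longrightarrow> (\<Sum>k\<in>A. {#f k#}) = image_mset f (mset_set A)"
  by (induction A rule: finite_induct) simp_all

text \<open>The factorization determines the multiset of roots, and a non-increasing enumeration of a multiset is
  unique.\<close>

lemma nth_eigenvalue_unique:
  fixes \<mu> :: "nat \<Rightarrow> real"
  assumes poly: "\<And>z. poly (char_poly M) z = (\<Prod>k\<in>{1..n}. z - complex_of_real (\<mu> k))"
    and mono: "\<And>j k. 1 \<le> j \<Longrightarrow> j \<le> k \<Longrightarrow> k \<le> n \<Longrightarrow> \<mu> k \<le> \<mu> j"
    and k: "k \<in> {1..n}"
  shows "nth_eigenvalue M k = \<mu> k"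
proof -
  let ?xs = "map \<mu> [1..<Suc n]"
  have "poly (char_poly M) = poly (\<Prod>k\<in>{1..n}. [:- complex_of_real (\<mu> k), 1:])"
    by (rule ext) (simp add: poly poly_prod)
  then have "char_poly M = (\<Prod>k\<in>{1..n}. [:- complex_of_real (\<mu> k), 1:])"
    by (simp only: poly_eq_poly_eq_iff)
  then have "proots (char_poly M) = (\<Sum>k\<in>{1..n}. {#complex_of_real (\<mu> k)#})"
    by (simp add: proots_prod)
  also have "\<dots> = image_mset (\<lambda>k. complex_of_real (\<mu> k)) (mset_set {1..n})"
    by (rule sum_singleton_mset) simp
  finally have "image_mset Re (proots (char_poly M)) = image_mset \<mu> (mset_set {1..n})"
    by (simp add: image_mset.compositionality o_def)
  also have "\<dots> = mset ?xs"
    by (simp add: mset_map atLeastLessThanSuc_atLeastAtMost del: upt_Suc flip: mset_set_set)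
  finally have ms: "image_mset Re (proots (char_poly M)) = mset (rev ?xs)" by simp
  have "sorted (rev ?xs)"
    by (auto simp: sorted_rev_iff_nth_mono nth_append simp del: upt_Suc intro!: mono)
  then have "rev (sorted_list_of_multiset (mset (rev ?xs))) = ?xs"
    by (simp only: sorted_list_of_multiset_mset sorted_sort_id rev_rev_ident)
  moreover have "?xs ! (k - 1) = \<mu> k"
    using k by (subst nth_map) (auto simp: nth_upt simp del: upt_Suc)
  ultimately show ?thesis
    by (simp only: nth_eigenvalue_def ms)
qed

text \<open>When all eigenvalues are real, taking real parts loses nothing, and \<open>nth_eigenvalue\<close> enumerates the roots of
  the characteristic polynomial with multiplicity.\<close>

lemma nth_eigenvalue_real_rooted:
  assumes M: "M \<in> carrier_mat n n" and real: "\<And>z. eigenvalue M z \<Longrightarrow> Im z = 0"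
  shows poly_char_poly_nth_eigenvalue:
      "poly (char_poly M) z = (\<Prod>k\<in>{1..n}. z - complex_of_real (nth_eigenvalue M k))"
    and nth_eigenvalue_antimono:
      "1 \<le> j \<Longrightarrow> j \<le> k \<Longrightarrow> k \<le> n \<Longrightarrow> nth_eigenvalue M k \<le> nth_eigenvalue M j"
    and nth_eigenvalue_eigenvalue:
      "k \<in> {1..n} \<Longrightarrow> eigenvalue M (complex_of_real (nth_eigenvalue M k))"
    and eigenvalue_nth_eigenvalue:
      "eigenvalue M y \<Longrightarrow> \<exists>k\<in>{1..n}. y = complex_of_real (nth_eigenvalue M k)"
proof -
  define R where "R = proots (char_poly M)"
  define ys where "ys = sorted_list_of_multiset (image_mset Re R)"
  have deg: "degree (char_poly M) = n" "lead_coeff (char_poly M) = 1"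
    using degree_monic_char_poly[OF M] by auto
  then have "char_poly M \<noteq> 0" by auto
  have "size R = n" unfolding R_def size_proots_complex deg ..
  then have len: "length ys = n"
    unfolding ys_def by (metis mset_sorted_list_of_multiset size_image_mset size_mset)
  have ev: "nth_eigenvalue M k = rev ys ! (k - 1)" for k
    by (simp add: nth_eigenvalue_def ys_def R_def)
  have re: "complex_of_real (Re z) = z" if "z \<in># R" for z
  proof -
    have "poly (char_poly M) z = 0" using that \<open>char_poly M \<noteq> 0\<close> by (simp add: R_def)
    then show ?thesis using real[of z] eigenvalue_root_char_poly[OF M] by (simp add: complex_eq_iff)
  qed
  have "R = image_mset (\<lambda>z. complex_of_real (Re z)) R"
    using re by (simp add: multiset.map_ident_strong)
  also have "\<dots> = mset (map complex_of_real (rev ys))"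
    by (simp add: ys_def image_mset.compositionality o_def)
  finally have R: "R = mset (map complex_of_real (rev ys))" .
  have prod: "poly (char_poly M) z = (\<Prod>k\<in>{1..n}. z - complex_of_real (nth_eigenvalue M k))" for z
  proof -
    have "char_poly M = (\<Prod>x\<in>#R. [:- x, 1:])"
      using complex_poly_decompose_multiset[of "char_poly M"] deg by (simp add: R_def)
    then have "poly (char_poly M) z = (\<Prod>x\<in>#R. z - x)"
      by (simp add: poly_prod_mset image_mset.compositionality o_def)
    also have "\<dots> = prod_list (map (\<lambda>x. z - complex_of_real x) (rev ys))"
      unfolding R by (simp only: mset_map[symmetric] prod_mset_prod_list map_map o_def)
    also have "\<dots> = (\<Prod>i = 0..<n. z - complex_of_real (rev ys ! i))"
      using len by (simp add: prod.list_conv_set_nth)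
    also have "\<dots> = (\<Prod>k\<in>{1..n}. z - complex_of_real (nth_eigenvalue M k))"
      by (rule prod.reindex_bij_witness[where i = "\<lambda>k. k - 1" and j = Suc]) (auto simp: ev)
    finally show ?thesis .
  qed
  then show "poly (char_poly M) z = (\<Prod>k\<in>{1..n}. z - complex_of_real (nth_eigenvalue M k))" .
  show "nth_eigenvalue M k \<le> nth_eigenvalue M j" if "1 \<le> j" "j \<le> k" "k \<le> n"
  proof -
    have "sorted ys" by (simp add: ys_def)
    then show ?thesis
      using sorted_rev_nth_mono[of "rev ys" "j - 1" "k - 1"] that len by (simp add: ev)
  qed
  show "eigenvalue M (complex_of_real (nth_eigenvalue M k))" if "k \<in> {1..n}"
    unfolding eigenvalue_root_char_poly[OF M] prod using that by (intro prod_zero) auto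
  show "\<exists>k\<in>{1..n}. y = complex_of_real (nth_eigenvalue M k)" if "eigenvalue M y"
    using that unfolding eigenvalue_root_char_poly[OF M] prod by auto
qed

text \<open>The eigenvalues are bounded by the Frobenius norm; this keeps them bounded along a continuous family on
  a compact set.\<close>

lemma eigenvalue_norm_le:
  assumes M: "M \<in> carrier_mat n n" and "eigenvalue M z"
  shows "(cmod z)\<^sup>2 \<le> (\<Sum>i<n. \<Sum>j<n. (cmod (M $$ (i, j)))\<^sup>2)"
proof -
  obtain v where v: "v \<in> carrier_vec n" "v \<noteq> 0\<^sub>v n" "M *\<^sub>v v = z \<cdot>\<^sub>v v"
    using assms unfolding eigenvalue_def eigenvector_def by auto
  define s where "s = (\<Sum>i<n. (cmod (v $ i))\<^sup>2)"
  obtain k where k: "k < n" "v $ k \<noteq> 0"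
    using v(1,2) by (metis carrier_vecD eq_vecI index_zero_vec)
  then have "0 < (cmod (v $ k))\<^sup>2" by simp
  also have "\<dots> \<le> s" unfolding s_def using k(1) by (intro member_le_sum) auto
  finally have "s > 0" .
  have "(cmod z)\<^sup>2 * s = (\<Sum>i<n. (cmod ((M *\<^sub>v v) $ i))\<^sup>2)"
    using v by (simp add: s_def norm_mult power_mult_distrib sum_distrib_left)
  also have "\<dots> \<le> (\<Sum>i<n. \<Sum>j<n. (cmod (M $$ (i, j)))\<^sup>2) * s"
    unfolding s_def by (rule mult_mat_vec_norm_le[OF M v(1)])
  finally show ?thesis using \<open>s > 0\<close> by simp
qed

text \<open>A bounded real function is continuous if its graph is closed. Let \<open>x m\<close> converge in such a way that the
  \<open>k\<close>-th eigenvalue converges, and pass to a subsequence along which all ordered eigenvalues converge,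
  say to \<open>\<mu>\<close>. The characteristic polynomials are products of linear factors with the ordered eigenvalues as
  roots, so in the limit \<open>\<mu>\<close> is a non-increasing list of the roots of the limit polynomial, that is, the list
  of ordered eigenvalues at the limit point.\<close>

lemma continuous_on_nth_eigenvalue:
  fixes M :: "'a::euclidean_space \<Rightarrow> complex mat"
  assumes "compact X" and M: "\<And>x. x \<in> X \<Longrightarrow> M x \<in> carrier_mat n n"
    and cont: "\<And>i j. i < n \<Longrightarrow> j < n \<Longrightarrow> continuous_on X (\<lambda>x. M x $$ (i, j))"
    and real: "\<And>x z. x \<in> X \<Longrightarrow> eigenvalue (M x) z \<Longrightarrow> Im z = 0"
    and k: "k \<in> {1..n}"
  shows "continuous_on X (\<lambda>x. nth_eigenvalue (M x) k)"
proof -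
  let ?ev = "\<lambda>x. nth_eigenvalue (M x)"
  have "continuous_on X (\<lambda>x. \<Sum>i<n. \<Sum>j<n. (cmod (M x $$ (i, j)))\<^sup>2)"
    by (intro continuous_intros cont) auto
  then have "bounded ((\<lambda>x. \<Sum>i<n. \<Sum>j<n. (cmod (M x $$ (i, j)))\<^sup>2) ` X)"
    using \<open>compact X\<close> by (intro compact_imp_bounded compact_continuous_image)
  then obtain B where B: "\<And>x. x \<in> X \<Longrightarrow> norm (\<Sum>i<n. \<Sum>j<n. (cmod (M x $$ (i, j)))\<^sup>2) \<le> B"
    unfolding bounded_iff by blast
  have ev_le: "\<bar>?ev x l\<bar> \<le> sqrt B" if "x \<in> X" "l \<in> {1..n}" for x l
  proof -
    have "(cmod (complex_of_real (?ev x l)))\<^sup>2 \<le> (\<Sum>i<n. \<Sum>j<n. (cmod (M x $$ (i, j)))\<^sup>2)"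
      by (rule eigenvalue_norm_le[OF M[OF that(1)]
            nth_eigenvalue_eigenvalue[OF M[OF that(1)] real[OF that(1)] that(2)]])
    also have "\<dots> \<le> B" using B[OF that(1)] by (simp add: sum_nonneg)
    finally show ?thesis by (simp add: real_le_rsqrt)
  qed
  have poly_cont: "continuous_on X (\<lambda>x. poly (char_poly (M x)) z)" for z
  proof -
    have "continuous_on X (\<lambda>x. det (- char_matrix (M x) z))"
    proof (rule continuous_on_det)
      show "- char_matrix (M x) z \<in> carrier_mat n n" if "x \<in> X" for x using M[OF that] by simp
      fix i j assume ij: "i < n" "j < n"
      have "continuous_on X (\<lambda>x. - (M x $$ (i, j) + - z * (1\<^sub>m n $$ (i, j))))"
        by (intro continuous_intros cont ij)
      then show "continuous_on X (\<lambda>x. (- char_matrix (M x) z) $$ (i, j))"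
        by (rule continuous_on_eq) (use ij carrier_matD[OF M] in \<open>simp add: char_matrix_def\<close>)
    qed
    then show ?thesis by (rule continuous_on_eq) (simp add: char_poly_matrix[OF M])
  qed
  show ?thesis
  proof (rule continuous_from_closed_graph)
    show "compact {- sqrt B..sqrt B}" by simp
    show "(\<lambda>x. ?ev x k) \<in> X \<rightarrow> {- sqrt B..sqrt B}"
    proof
      fix x assume "x \<in> X"
      then show "?ev x k \<in> {- sqrt B..sqrt B}" using ev_le[of x k] k by (simp add: abs_le_iff)
    qed
    show "closed ((\<lambda>x. (x, ?ev x k)) ` X)"
      unfolding closed_sequential_limits
    proof (intro allI impI, elim conjE)
      fix s :: "nat \<Rightarrow> 'a \<times> real" and y
      assume s: "\<forall>m. s m \<in> (\<lambda>x. (x, ?ev x k)) ` X" and lim: "s \<longlonglongrightarrow> y"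
      define x where "x m = fst (s m)" for m
      have x: "x m \<in> X" "snd (s m) = ?ev (x m) k" for m
      proof -
        from s have "s m \<in> (\<lambda>x. (x, ?ev x k)) ` X" by (rule spec)
        then obtain x' where "x' \<in> X" "s m = (x', ?ev x' k)" by (elim imageE)
        then show "x m \<in> X" "snd (s m) = ?ev (x m) k" by (simp_all add: x_def)
      qed
      have x_lim: "x \<longlonglongrightarrow> fst y" unfolding x_def by (rule tendsto_fst[OF lim])
      have y: "fst y \<in> X"
        using compact_imp_closed[OF \<open>compact X\<close>] x(1) x_lim by (rule closed_sequentially)
      obtain \<mu> r where r: "strict_mono (r :: nat \<Rightarrow> nat)"
        and "\<forall>e>0. \<forall>\<^sub>F m in sequentially. \<forall>l\<in>{1..n}. dist (?ev (x (r m)) l) (\<mu> l) < e"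
      proof -
        have "\<forall>d\<subseteq>{1..n}. \<exists>l r. strict_mono (r :: nat \<Rightarrow> nat) \<and>
            (\<forall>e>0. \<forall>\<^sub>F m in sequentially. \<forall>i\<in>d. dist ((\<lambda>m. ?ev (x m)) (r m) i) (l i) < e)"
        proof (rule compact_lemma_general[where unproj = id])
          show "bounded ((\<lambda>f. f i) ` range (\<lambda>m. ?ev (x m)))" if "i \<in> {1..n}" for i
            using ev_le[OF x(1) that] by (intro boundedI[of _ "sqrt B"]) auto
        qed simp_all
        from this[rule_format, OF subset_refl] show thesis
          by (elim exE conjE) (rule that)
      qed
      note conv = this(2)
      have \<mu>: "(\<lambda>m. ?ev (x (r m)) l) \<longlonglongrightarrow> \<mu> l" if "l \<in> {1..n}" for l
        unfolding tendsto_iff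
      proof (intro allI impI)
        fix e :: real assume "0 < e"
        with conv have "\<forall>\<^sub>F m in sequentially. \<forall>l\<in>{1..n}. dist (?ev (x (r m)) l) (\<mu> l) < e"
          by simp
        then show "\<forall>\<^sub>F m in sequentially. dist (?ev (x (r m)) l) (\<mu> l) < e"
          by (rule eventually_mono) (rule bspec[OF _ that])
      qed
      have xr_lim: "(\<lambda>m. x (r m)) \<longlonglongrightarrow> fst y"
        using LIMSEQ_subseq_LIMSEQ[OF x_lim r] by (simp add: o_def)
      have "?ev (fst y) k = \<mu> k"
      proof (rule nth_eigenvalue_unique[OF _ _ k])
        fix z
        have "(\<lambda>m. poly (char_poly (M (x (r m)))) z) \<longlonglongrightarrow> poly (char_poly (M (fst y))) z"
          by (rule continuous_on_tendsto_compose[OF poly_cont xr_lim y]) (simp add: x(1))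
        moreover have "poly (char_poly (M (x (r m)))) z = (\<Prod>l\<in>{1..n}. z - complex_of_real (?ev (x (r m)) l))" for m
          by (rule poly_char_poly_nth_eigenvalue[OF M[OF x(1)] real[OF x(1)]])
        ultimately have "(\<lambda>m. \<Prod>l\<in>{1..n}. z - complex_of_real (?ev (x (r m)) l))
            \<longlonglongrightarrow> poly (char_poly (M (fst y))) z"
          by (simp only:)
        moreover have "(\<lambda>m. \<Prod>l\<in>{1..n}. z - complex_of_real (?ev (x (r m)) l))
            \<longlonglongrightarrow> (\<Prod>l\<in>{1..n}. z - complex_of_real (\<mu> l))"
          by (intro tendsto_intros \<mu>)
        ultimately show "poly (char_poly (M (fst y))) z = (\<Prod>l\<in>{1..n}. z - complex_of_real (\<mu> l))"
          by (rule LIMSEQ_unique)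
      next
        fix i j assume ij: "1 \<le> i" "i \<le> j" "j \<le> n"
        show "\<mu> j \<le> \<mu> i"
        proof (rule LIMSEQ_le[OF \<mu> \<mu>])
          show "\<exists>N. \<forall>m\<ge>N. ?ev (x (r m)) j \<le> ?ev (x (r m)) i"
            by (intro exI allI impI) (rule nth_eigenvalue_antimono[OF M[OF x(1)] real[OF x(1)] ij])
        qed (use ij in simp_all)
      qed
      moreover have "(\<lambda>m. ?ev (x (r m)) k) \<longlonglongrightarrow> snd y"
        using LIMSEQ_subseq_LIMSEQ[OF tendsto_snd[OF lim] r] x(2) by (simp add: o_def)
      ultimately have "?ev (fst y) k = snd y"
        using LIMSEQ_unique[OF \<mu>[OF k]] by simp
      then show "y \<in> (\<lambda>x. (x, ?ev x k)) ` X"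
        by (intro image_eqI[OF _ y]) (simp add: prod_eq_iff)
    qed
  qed
qed

section \<open>Gaps between finitely many intervals\<close>

text \<open>If a boundary point of the component did not belong to \<open>U\<close>, it could be added to the component, which
  would remain connected; this contradicts maximality.\<close>

lemma gap_endpoints:
  fixes U G :: "real set"
  assumes "closed U" and G: "G \<in> components (- U)" and "bounded G"
  shows "Inf G \<in> U" and "Sup G \<in> U" and "\<And>g. g \<in> G \<Longrightarrow> Inf G < g \<and> g < Sup G"
proof -
  have "open G" using \<open>closed U\<close> G by (intro open_components[OF _ G]) (simp add: open_Compl)
  have "G \<noteq> {}" "G \<subseteq> - U" "connected G"
    using G in_components_nonempty in_components_subset in_components_connected by blast+
  have bdd: "bdd_above G" "bdd_below G"
    using \<open>bounded G\<close> by (simp_all add: bounded_imp_bdd_above bounded_imp_bdd_below)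
  obtain B where B: "\<And>x. x \<in> G \<Longrightarrow> \<bar>x\<bar> \<le> B"
    using \<open>bounded G\<close> unfolding bounded_real by blast
  have notin: "Inf G \<notin> G" "Sup G \<notin> G"
  proof -
    have bounds: "- B - 1 < x" "x < B + 1" if "x \<in> G" for x
      using B[OF that] by (simp_all add: abs_le_iff)
    show "Inf G \<notin> G"
      by (rule Inf_notin_open[OF \<open>open G\<close>]) (rule ballI, rule bounds(1))
    show "Sup G \<notin> G"
      by (rule Sup_notin_open[OF \<open>open G\<close>]) (rule ballI, rule bounds(2))
  qed
  have boundary: "x \<in> U" if x: "x \<in> closure G" "x \<notin> G" for x
  proof (rule ccontr)
    assume "x \<notin> U"
    have "connected (insert x G)"
      by (rule connected_intermediate_closure[OF \<open>connected G\<close> subset_insertI])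
         (simp add: x(1) closure_subset)
    moreover have "insert x G \<subseteq> - U" using \<open>x \<notin> U\<close> \<open>G \<subseteq> - U\<close> by simp
    moreover have "G \<inter> insert x G \<noteq> {}" using \<open>G \<noteq> {}\<close> by blast
    ultimately have "insert x G \<subseteq> G" by (intro components_maximal[OF G])
    then show False using x(2) by simp
  qed
  show "Inf G \<in> U" "Sup G \<in> U"
    using boundary notin closure_contains_Inf[OF \<open>G \<noteq> {}\<close> bdd(2)] closure_contains_Sup[OF \<open>G \<noteq> {}\<close> bdd(1)]
    by blast+
  show "Inf G < g \<and> g < Sup G" if "g \<in> G" for g
    using cInf_lower[OF that bdd(2)] cSup_upper[OF that bdd(1)] notin that
    by (metis order_le_imp_less_or_eq)
qed

text \<open>The right end of a bounded gap belongs to some interval and is its left end, since points just below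
  are not in \<open>U\<close>. It is not the least left end, because the left end of the gap lies in \<open>U\<close> too. Two gaps
  with the same right end overlap just below it, so they coincide.\<close>

lemma finite_union_intervals_gaps:
  fixes l u :: "nat \<Rightarrow> real"
  assumes "1 \<le> p" and lu: "\<And>k. k \<in> {1..p} \<Longrightarrow> l k \<le> u k"
  defines "U \<equiv> \<Union>k\<in>{1..p}. {l k..u k}"
  shows "finite {G \<in> components (- U). bounded G} \<and> card {G \<in> components (- U). bounded G} \<le> p - 1"
proof -
  let ?gaps = "{G \<in> components (- U). bounded G}"
  let ?L = "l ` {1..p}"
  have "closed U" unfolding U_def by (intro closed_UN) simp_all
  have fin: "finite ?L" "?L \<noteq> {}" using \<open>1 \<le> p\<close> by auto
  have nonempty: "G \<noteq> {}" and conn: "connected G" and sub: "G \<subseteq> - U" if "G \<in> ?gaps" for G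
    using that in_components_nonempty in_components_subset in_components_connected by blast+
  have "Sup ` ?gaps \<subseteq> ?L - {Min ?L}"
  proof (intro image_subsetI)
    fix G assume G: "G \<in> ?gaps"
    then have comp: "G \<in> components (- U)" "bounded G" by simp_all
    note ends = gap_endpoints[OF \<open>closed U\<close> comp]
    obtain k where k: "k \<in> {1..p}" "l k \<le> Sup G" "Sup G \<le> u k"
      using ends(2) unfolding U_def by (elim UN_E) (simp add: that)
    have "\<not> l k < Sup G"
    proof
      assume "l k < Sup G"
      then obtain g where "g \<in> G" "l k < g"
        using less_cSup_iff[OF nonempty[OF G] bounded_imp_bdd_above[OF comp(2)]] by blast
      then have "g \<in> {l k..u k}" using k(3) ends(3)[of g] by simp
      then have "g \<in> U" unfolding U_def using k(1) by blast
      then show False using sub[OF G] \<open>g \<in> G\<close> by blast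
    qed
    then have "Sup G \<in> ?L" using k by (intro image_eqI[of _ _ k]) simp_all
    moreover have "Min ?L < Sup G"
    proof -
      obtain j where j: "j \<in> {1..p}" "l j \<le> Inf G"
        using ends(1) unfolding U_def by (elim UN_E) (simp add: that)
      obtain g where "g \<in> G" using nonempty[OF G] by blast
      have "Min ?L \<le> l j" using fin(1) j(1) by (intro Min_le) auto
      also note j(2)
      also have "Inf G < Sup G" using ends(3)[OF \<open>g \<in> G\<close>] by linarith
      finally show ?thesis .
    qed
    ultimately show "Sup G \<in> ?L - {Min ?L}" by simp
  qed
  moreover have "inj_on Sup ?gaps"
  proof (rule inj_onI)
    fix G H assume G: "G \<in> ?gaps" and H: "H \<in> ?gaps" and eq: "Sup G = Sup H"
    obtain g h where gh: "g \<in> G" "h \<in> H" using nonempty[OF G] nonempty[OF H] by blast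
    have G': "G \<in> components (- U)" "bounded G" and H': "H \<in> components (- U)" "bounded H"
      using G H by simp_all
    define x where "x = max g h"
    have "g < Sup G" "h < Sup H"
      using gap_endpoints(3)[OF \<open>closed U\<close> G' gh(1)] gap_endpoints(3)[OF \<open>closed U\<close> H' gh(2)] by simp_all
    then have x: "x < Sup G" "x < Sup H" using eq by (simp_all add: x_def)
    obtain y where y: "y \<in> G" "x < y"
      using x(1) less_cSup_iff[OF nonempty[OF G] bounded_imp_bdd_above[OF G'(2)]] by blast
    obtain z where z: "z \<in> H" "x < z"
      using x(2) less_cSup_iff[OF nonempty[OF H] bounded_imp_bdd_above[OF H'(2)]] by blast
    have "{g..y} \<subseteq> G" "{h..z} \<subseteq> H"
      using connected_contains_Icc[OF conn[OF G] gh(1) y(1)] connected_contains_Icc[OF conn[OF H] gh(2) z(1)] .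
    moreover have "x \<in> {g..y}" "x \<in> {h..z}" using y(2) z(2) by (simp_all add: x_def)
    ultimately have "x \<in> G \<inter> H" by blast
    then show "G = H" using components_nonoverlap[OF G'(1) H'(1)] by blast
  qed
  moreover have "finite (?L - {Min ?L})" using fin by simp
  ultimately have "finite ?gaps" "card ?gaps \<le> card (?L - {Min ?L})"
    using inj_on_finite card_inj_on_le by blast+
  moreover have "card (?L - {Min ?L}) \<le> p - 1"
    using fin card_image_le[of "{1..p}" l] by (simp add: card_Diff_singleton)
  ultimately show ?thesis by simp
qed

section \<open>Bands and gaps of the spectrum\<close>

lemma torus_image:
  assumes "\<And>x1 x2 y1 y2. cis x1 = cis y1 \<Longrightarrow> cis x2 = cis y2 \<Longrightarrow> f (x1, x2) = f (y1, y2)"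
  shows "f ` torus = f ` ({0..2 * pi} \<times> {0..2 * pi})"
proof (rule subset_antisym)
  show "f ` torus \<subseteq> f ` ({0..2 * pi} \<times> {0..2 * pi})"
    unfolding torus_def by (intro image_mono Sigma_mono) auto
  show "f ` ({0..2 * pi} \<times> {0..2 * pi}) \<subseteq> f ` torus"
  proof (intro image_subsetI)
    fix x :: "real \<times> real"
    obtain y1 y2 where "(y1, y2) \<in> torus" "cis (fst x) = cis y1" "cis (snd x) = cis y2"
      using ex_torus_cis by blast
    then show "f x \<in> f ` torus"
      using assms[of "fst x" y1 "snd x" y2] by (intro image_eqI[of _ _ "(y1, y2)"]) simp_all
  qed
qed

text \<open>On the closed square the infimum and the supremum are attained and all values between them are taken;
  the half-open torus has the same image by periodicity.\<close>

lemma band_eq_image: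
  fixes f :: "real \<Rightarrow> real \<Rightarrow> real"
  assumes cont: "continuous_on ({0..2 * pi} \<times> {0..2 * pi}) (\<lambda>x. f (fst x) (snd x))"
    and per: "\<And>x1 x2 y1 y2. cis x1 = cis y1 \<Longrightarrow> cis x2 = cis y2 \<Longrightarrow> f x1 x2 = f y1 y2"
  shows "band f = (\<lambda>(x1, x2). f x1 x2) ` torus \<and> (\<exists>l u. l \<le> u \<and> band f = {l..u})"
proof -
  let ?f = "\<lambda>(x1, x2). f x1 x2" and ?X = "{0..2 * pi} \<times> {0..2 * pi}"
  have img: "?f ` torus = ?f ` ?X"
    by (rule torus_image) (simp only: case_prod_conv, rule per)
  have cont': "continuous_on ?X ?f" using cont by (simp add: case_prod_unfold)
  have "connected ?X" by (intro connected_Times) simp_all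
  have "compact ?X" by (intro compact_Times compact_Icc)
  have "connected (?f ` ?X)"
    by (rule connected_continuous_image[OF cont' \<open>connected ?X\<close>])
  moreover have "compact (?f ` ?X)"
    by (rule compact_continuous_image[OF cont' \<open>compact ?X\<close>])
  ultimately have "\<exists>l u. ?f ` ?X = {l..u}"
    unfolding connected_compact_interval_1[symmetric] by (rule conjI)
  then obtain l u where lu: "?f ` ?X = {l..u}" by (elim exE)
  have "?f (0, 0) \<in> ?f ` ?X" by (rule imageI) simp
  then have "l \<le> u" unfolding lu by simp
  then have "band f = {l..u}"
    unfolding band_def img lu by simp
  then show ?thesis using \<open>l \<le> u\<close> unfolding img lu by (intro conjI exI)
qed

theorem corollary2p3:
  fixes p1 p2 p :: nat
    and a c :: "int \<Rightarrow> int \<Rightarrow> real"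
    and \<alpha> b :: "int \<Rightarrow> int \<Rightarrow> complex"
  defines "p \<equiv> p1 * p2"
    and "J \<equiv> jacobi_block_jacobi a \<alpha> c b"
    and "ev \<equiv> (\<lambda>k x1 x2. nth_eigenvalue (jbj_symbol p1 p2 a \<alpha> c b x1 x2) k)"
  assumes "p1 \<ge> 2" and "p2 \<ge> 2"
    and "doubly_periodic p1 p2 a" and "doubly_periodic p1 p2 \<alpha>"
    and "doubly_periodic p1 p2 c" and "doubly_periodic p1 p2 b"
  shows "operator_spectrum J = complex_of_real ` (\<Union>k\<in>{1..p}. band (ev k))
       \<and> finite (spectral_gaps (operator_spectrum J))
       \<and> card (spectral_gaps (operator_spectrum J)) \<le> p - 1"
proof -
  let ?S = "jbj_symbol p1 p2 a \<alpha> c b"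
  have S: "?S x1 x2 \<in> carrier_mat p p" for x1 x2
    unfolding p_def by (rule jbj_symbol_carrier)
  note real = eigenvalue_jbj_symbol_real[OF assms(4-9)]
  have band: "band (ev k) = (\<lambda>(x1, x2). ev k x1 x2) ` torus \<and> (\<exists>l u. l \<le> u \<and> band (ev k) = {l..u})"
    if k: "k \<in> {1..p}" for k
  proof (rule band_eq_image)
    show "continuous_on ({0..2 * pi} \<times> {0..2 * pi}) (\<lambda>x. ev k (fst x) (snd x))"
      unfolding ev_def
    proof (rule continuous_on_nth_eigenvalue[OF _ S _ real k])
      show "compact ({0..2 * pi} \<times> {0..2 * pi} :: (real \<times> real) set)"
        by (intro compact_Times compact_Icc)
    qed (simp_all add: p_def continuous_on_jbj_symbol)
    show "ev k x1 x2 = ev k y1 y2" if "cis x1 = cis y1" "cis x2 = cis y2" for x1 x2 y1 y2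
      unfolding ev_def jbj_symbol_cong_cis[OF that] ..
  qed
  have spectrum: "operator_spectrum J = complex_of_real ` (\<Union>k\<in>{1..p}. band (ev k))"
  proof (intro subset_antisym subsetI)
    fix z assume "z \<in> operator_spectrum J"
    then obtain x1 x2 where x: "(x1, x2) \<in> torus" "eigenvalue (?S x1 x2) z"
      unfolding J_def operator_spectrum_jbj[OF assms(4-9)] by (elim CollectE bexE) (simp add: that split: prod.splits)
    have "\<exists>k\<in>{1..p}. z = complex_of_real (ev k x1 x2)"
      unfolding ev_def by (rule eigenvalue_nth_eigenvalue[OF S _ x(2)]) (rule real)
    then obtain k where k: "k \<in> {1..p}" "z = complex_of_real (ev k x1 x2)" by (elim bexE)
    have "ev k x1 x2 \<in> band (ev k)"
      unfolding conjunct1[OF band[OF k(1)]] by (rule image_eqI[OF _ x(1)]) simp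
    then have "ev k x1 x2 \<in> (\<Union>k\<in>{1..p}. band (ev k))" by (rule UN_I[OF k(1)])
    then show "z \<in> complex_of_real ` (\<Union>k\<in>{1..p}. band (ev k))"
      unfolding k(2) by (rule imageI)
  next
    fix z assume "z \<in> complex_of_real ` (\<Union>k\<in>{1..p}. band (ev k))"
    then obtain t where t: "z = complex_of_real t" "t \<in> (\<Union>k\<in>{1..p}. band (ev k))" by (elim imageE)
    from t(2) obtain k where k: "k \<in> {1..p}" "t \<in> band (ev k)" by (elim UN_E)
    from k(2) obtain x where x: "t = (case x of (x1, x2) \<Rightarrow> ev k x1 x2)" "x \<in> torus"
      unfolding conjunct1[OF band[OF k(1)]] by (elim imageE)
    obtain x1 x2 where [simp]: "x = (x1, x2)" by (cases x)
    have "eigenvalue (?S x1 x2) z"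
      using nth_eigenvalue_eigenvalue[OF S _ k(1)] real by (simp add: t(1) x(1) ev_def)
    then show "z \<in> operator_spectrum J"
      unfolding J_def operator_spectrum_jbj[OF assms(4-9)]
      by (intro CollectI bexI[OF _ x(2)]) simp
  qed
  have "\<forall>k\<in>{1..p}. \<exists>l u. l \<le> u \<and> band (ev k) = {l..u}" using band by blast
  then obtain l u where lu: "\<And>k. k \<in> {1..p} \<Longrightarrow> l k \<le> u k" "\<And>k. k \<in> {1..p} \<Longrightarrow> band (ev k) = {l k..u k}"
    by metis
  have "(\<Union>k\<in>{1..p}. band (ev k)) = (\<Union>k\<in>{1..p}. {l k..u k})"
    using lu(2) by (intro SUP_cong) simp_all
  then have "{t. complex_of_real t \<notin> operator_spectrum J} = - (\<Union>k\<in>{1..p}. {l k..u k})"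
    unfolding spectrum by auto
  moreover have "1 \<le> p" using assms(4,5) by (simp add: p_def Suc_le_eq)
  ultimately show ?thesis
    using spectrum finite_union_intervals_gaps[OF _ lu(1), of p] unfolding spectral_gaps_def by simp
qed

end
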